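(* Let $\mathcal{T}$ be a tableau. Any two disjunctive formulas of the modal $\mu$-calculus whose tableaus are both equivalent to $\mathcal{T}$ (equivalently: any two tableau equivalent disjunctive formulas) have the same alternation depth.
   Context: Formulas of the (unimodal) modal $\mu$-calculus $L_\mu$ over propositions $P,Q,\dots$ and fixpoint variables $X,Y,\dots$ are given by $\phi ::= \top \mid \bot \mid P \mid \neg P \mid X \mid \phi\wedge\phi \mid \phi\vee\phi \mid \rightarrow\mathcal{B} \mid \mu X.\phi \mid \nu X.\phi$, where $\mathcal{B}$ is a finite set of formulas and $\rightarrow\mathcal{B}$ means $(\bigwedge_{\phi\in\mathcal{B}}\Diamond\phi)\wedge\Box\bigvee_{\phi\in\mathcal{B}}\phi$; formulas are guarded (every variable occurs under a modality inside its binder). Literals are propositions and their negations. Disjunctive formulas: the smallest set $\mathcal{F}$ containing $\top,\bot$ and all literals, closed under $\vee$, under $\mu X.\psi$ and $\nu X.\psi$ for $\psi\in\mathcal{F}$, and containing $\bigwedge\mathcal{A}\wedge\rightarrow\mathcal{B}$ whenever $\mathcal{A}$ is a finite set of literals and $\mathcal{B}\subseteq\mathcal{F}$ is finite. Priority assignment / alternation depth: a priority assignment of a formula is a map $\Omega$ from its bound fixpoint variables to $\{0,\dots,n\}$, surjective onto $\{1,\dots,n\}$, with $\Omega(X)$ even for $\nu$-bound and odd for $\mu$-bound variables, and such that if $\Omega(X)<\Omega(Y)$ then $X$ does not occur free in the formula binding $Y$. The alternation depth of a formula is the co-domain $\{0,\dots,n\}$ of a priority assignment with least $n$. Tableau of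 $\Psi$: a (possibly infinite) tree whose nodes are labelled by sets of subformulas of $\Psi$, with root label $\{\Psi\}$, built by the rules: $\{\Gamma,\psi\wedge\phi\}$ has child $\{\Gamma,\psi,\phi\}$; $\{\Gamma,\psi\vee\phi\}$ has children $\{\Gamma,\psi\}$ and $\{\Gamma,\phi\}$; $\{\Gamma,\sigma X.\phi\}$ has child $\{\Gamma,\phi\}$; $\{\Gamma,X\}$ has child $\{\Gamma,\phi\}$ where $\sigma X.\phi$ binds $X$; and, only when no other rule applies (so the label consists of modal formulas and literals), the modal rule: $\{\Gamma\}$ has, for every $\rightarrow\mathcal{B}'\in\Gamma$ and $\psi\in\mathcal{B}'$, a child $\{\psi\}\cup\{\bigvee\mathcal{B}\mid \rightarrow\mathcal{B}\in\Gamma,\ \mathcal{B}\ne\mathcal{B}'\}$; a modal node with inconsistent literals has no children. A trace on an infinite branch is a sequence of formulas, one from each label, following the rule applied (unchanged if not acted upon, immediate subformula for $\wedge,\vee,\sigma$, $\bigvee\mathcal{B}$ or a member of $\mathcal{B}$ across a modal step from $\rightarrow\mathcal{B}$, binding formula on regeneration of a variable). It is a $\mu$-trace if the outermost (most significant) fixpoint variable regenerated infinitely often on it is $\mu$-bound. An infinite branch is odd if it carries a $\mu$-trace, even otherwise. Tableau core: collapse consecutive disjunction steps into one node and keep only branching nodes, each typed as modal (with its set of literals) or disjunctive, with the successor structure and the parity of infinite paths. Two tableaus are equivalent if their cores are bisimilar with respect to branching structure, node type, literals at modal nodes and parity of infinite paths; two formulas are tableau equivalent if their tableaus are equivalent.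
   Formalization: Added: in both disjunctive formulas no fixpoint variable occurs below a conjunction ⋀A∧→B with A inconsistent; otherwise μX.((P∧¬P)∧→{X}) and (P∧¬P)∧→{⊤} are tableau equivalent but have alternation depths {0,1} and {0}. *)

theory Defs
  imports Main "HOL-Library.FSet" "HOL-Library.Sublist"
begin

section \<open>Formulas\<close>

text \<open>
  \<open>Arrow B\<close> is the modality \<open>\<rightarrow>B\<close>, i.e. every formula in \<open>B\<close> holds at some successor and
  every successor satisfies some formula in \<open>B\<close>.
\<close>

datatype ('p, 'v) fm =
    Top
  | Bot
  | Prop 'p
  | NProp 'p
  | Var 'v
  | And "('p, 'v) fm" "('p, 'v) fm"
  | Or "('p, 'v) fm" "('p, 'v) fm"
  | Arrow "('p, 'v) fm fset"
  | Mu 'v "('p, 'v) fm"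
  | Nu 'v "('p, 'v) fm"

primrec subfms :: "('p, 'v) fm \<Rightarrow> ('p, 'v) fm set" where
  "subfms Top = {Top}"
| "subfms Bot = {Bot}"
| "subfms (Prop p) = {Prop p}"
| "subfms (NProp p) = {NProp p}"
| "subfms (Var X) = {Var X}"
| "subfms (And \<phi> \<psi>) = insert (And \<phi> \<psi>) (subfms \<phi> \<union> subfms \<psi>)"
| "subfms (Or \<phi> \<psi>) = insert (Or \<phi> \<psi>) (subfms \<phi> \<union> subfms \<psi>)"
| "subfms (Arrow B) = insert (Arrow B) (\<Union> (fset (subfms |`| B)))"
| "subfms (Mu X \<phi>) = insert (Mu X \<phi>) (subfms \<phi>)"
| "subfms (Nu X \<phi>) = insert (Nu X \<phi>) (subfms \<phi>)"

primrec free_vars :: "('p, 'v) fm \<Rightarrow> 'v set" where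
  "free_vars Top = {}"
| "free_vars Bot = {}"
| "free_vars (Prop p) = {}"
| "free_vars (NProp p) = {}"
| "free_vars (Var X) = {X}"
| "free_vars (And \<phi> \<psi>) = free_vars \<phi> \<union> free_vars \<psi>"
| "free_vars (Or \<phi> \<psi>) = free_vars \<phi> \<union> free_vars \<psi>"
| "free_vars (Arrow B) = \<Union> (fset (free_vars |`| B))"
| "free_vars (Mu X \<phi>) = free_vars \<phi> - {X}"
| "free_vars (Nu X \<phi>) = free_vars \<phi> - {X}"

text \<open>Variables with a free occurrence that is not under a modality.\<close>

primrec unguarded_vars :: "('p, 'v) fm \<Rightarrow> 'v set" where
  "unguarded_vars Top = {}"
| "unguarded_vars Bot = {}"
| "unguarded_vars (Prop p) = {}"
| "unguarded_vars (NProp p) = {}"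
| "unguarded_vars (Var X) = {X}"
| "unguarded_vars (And \<phi> \<psi>) = unguarded_vars \<phi> \<union> unguarded_vars \<psi>"
| "unguarded_vars (Or \<phi> \<psi>) = unguarded_vars \<phi> \<union> unguarded_vars \<psi>"
| "unguarded_vars (Arrow B) = {}"
| "unguarded_vars (Mu X \<phi>) = unguarded_vars \<phi> - {X}"
| "unguarded_vars (Nu X \<phi>) = unguarded_vars \<phi> - {X}"

definition mu_bound :: "('p, 'v) fm \<Rightarrow> 'v set" where
  "mu_bound \<Psi> = {X. \<exists>\<phi>. Mu X \<phi> \<in> subfms \<Psi>}"

definition nu_bound :: "('p, 'v) fm \<Rightarrow> 'v set" where
  "nu_bound \<Psi> = {X. \<exists>\<phi>. Nu X \<phi> \<in> subfms \<Psi>}"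

definition bound_vars :: "('p, 'v) fm \<Rightarrow> 'v set" where
  "bound_vars \<Psi> = mu_bound \<Psi> \<union> nu_bound \<Psi>"

text \<open>\<open>binds \<Psi> X \<beta> \<phi>\<close>: the subformula \<open>\<beta>\<close> of \<open>\<Psi>\<close> is \<open>\<sigma>X. \<phi>\<close>.\<close>

definition binds :: "('p, 'v) fm \<Rightarrow> 'v \<Rightarrow> ('p, 'v) fm \<Rightarrow> ('p, 'v) fm \<Rightarrow> bool" where
  "binds \<Psi> X \<beta> \<phi> \<longleftrightarrow> \<beta> \<in> subfms \<Psi> \<and> (\<beta> = Mu X \<phi> \<or> \<beta> = Nu X \<phi>)"

definition well_named :: "('p, 'v) fm \<Rightarrow> bool" where
  "well_named \<Psi> \<longleftrightarrow>
     (\<forall>X \<beta> \<beta>' \<phi> \<phi>'. binds \<Psi> X \<beta> \<phi> \<longrightarrow> binds \<Psi> X \<beta>' \<phi>' \<longrightarrow> \<beta> = \<beta>') \<and>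
     free_vars \<Psi> \<inter> bound_vars \<Psi> = {}"

text \<open>
  Guardedness includes that the bound variable does occur in the scope of its binder. Vacuous
  binders have to be excluded: \<open>\<mu>X. P\<close> and \<open>P\<close> have the same tableau core, but any
  priority assignment gives \<open>X\<close> an odd priority.
\<close>

definition guarded :: "('p, 'v) fm \<Rightarrow> bool" where
  "guarded \<Psi> \<longleftrightarrow>
     (\<forall>X \<beta> \<phi>. binds \<Psi> X \<beta> \<phi> \<longrightarrow> X \<in> free_vars \<phi> \<and> X \<notin> unguarded_vars \<phi>)"

definition well_formed :: "('p, 'v) fm \<Rightarrow> bool" where
  "well_formed \<Psi> \<longleftrightarrow> well_named \<Psi> \<and> guarded \<Psi>"


section \<open>Disjunctive formulas\<close>

definition literals :: "('p, 'v) fm set" where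
  "literals = range Prop \<union> range NProp"

definition consistent :: "('p, 'v) fm set \<Rightarrow> bool" where
  "consistent L \<longleftrightarrow> Bot \<notin> L \<and> \<not> (\<exists>p. Prop p \<in> L \<and> NProp p \<in> L)"

fun conj_list :: "('p, 'v) fm list \<Rightarrow> ('p, 'v) fm" where
  "conj_list [] = Top"
| "conj_list [\<phi>] = \<phi>"
| "conj_list (\<phi> # \<psi> # \<phi>s) = And \<phi> (conj_list (\<psi> # \<phi>s))"

fun disj_list :: "('p, 'v) fm list \<Rightarrow> ('p, 'v) fm" where
  "disj_list [] = Bot"
| "disj_list [\<phi>] = \<phi>"
| "disj_list (\<phi> # \<psi> # \<phi>s) = Or \<phi> (disj_list (\<psi> # \<phi>s))"

text \<open>
  The big disjunction of a finite set, for an arbitrary but fixed enumeration of that set; tableau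
  cores do not depend on the enumeration, because consecutive disjunctions are collapsed.
\<close>

definition big_disj :: "('p, 'v) fm fset \<Rightarrow> ('p, 'v) fm" where
  "big_disj B = disj_list (SOME \<phi>s. distinct \<phi>s \<and> set \<phi>s = fset B)"

text \<open>
  In the last two rules the finite set of literals is given by an arbitrary enumeration \<open>as\<close>; for
  the empty set, the empty conjunction may be written as \<open>Top\<close> or omitted.
\<close>

inductive disjunctive :: "('p, 'v) fm \<Rightarrow> bool" where
  "disjunctive Top"
| "disjunctive Bot"
| "a \<in> literals \<Longrightarrow> disjunctive a"
| "disjunctive (Var X)"
| "disjunctive \<phi> \<Longrightarrow> disjunctive \<psi> \<Longrightarrow> disjunctive (Or \<phi> \<psi>)"
| "disjunctive \<phi> \<Longrightarrow> disjunctive (Mu X \<phi>)"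
| "disjunctive \<phi> \<Longrightarrow> disjunctive (Nu X \<phi>)"
| "(\<And>\<beta>. \<beta> \<in> fset B \<Longrightarrow> disjunctive \<beta>) \<Longrightarrow> disjunctive (Arrow B)"
| "set as \<subseteq> literals \<Longrightarrow> (\<And>\<beta>. \<beta> \<in> fset B \<Longrightarrow> disjunctive \<beta>) \<Longrightarrow>
     disjunctive (And (conj_list as) (Arrow B))"

text \<open>
  No fixpoint variable occurs below an inconsistent conjunction of literals. A tableau stops at
  such a conjunction, so that fixpoints below it count for the alternation depth but leave no trace
  in the tableau: for instance \<open>(P \<and> \<not>P) \<and> \<rightarrow>{\<top>}\<close> and \<open>\<mu>X. (P \<and> \<not>P) \<and> \<rightarrow>{X}\<close> have
  the same tableau core.
\<close>

definition no_dead_fixpoints :: "('p, 'v) fm \<Rightarrow> bool" where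
  "no_dead_fixpoints \<Psi> \<longleftrightarrow>
     (\<forall>as B. And (conj_list as) (Arrow B) \<in> subfms \<Psi> \<longrightarrow>
        set as \<subseteq> literals \<longrightarrow> \<not> consistent (set as) \<longrightarrow>
        free_vars (Arrow B) = {} \<and> bound_vars (Arrow B) = {})"


section \<open>Alternation depth\<close>

definition priority_assignment :: "('p, 'v) fm \<Rightarrow> nat \<Rightarrow> ('v \<Rightarrow> nat) \<Rightarrow> bool" where
  "priority_assignment \<Psi> n \<Omega> \<longleftrightarrow>
     \<Omega> ` bound_vars \<Psi> \<subseteq> {0..n} \<and>
     {1..n} \<subseteq> \<Omega> ` bound_vars \<Psi> \<and>
     (\<forall>X \<in> nu_bound \<Psi>. even (\<Omega> X)) \<and>
     (\<forall>X \<in> mu_bound \<Psi>. odd (\<Omega> X)) \<and>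
     (\<forall>X \<in> bound_vars \<Psi>. \<forall>Y \<in> bound_vars \<Psi>. \<Omega> X < \<Omega> Y \<longrightarrow>
        (\<forall>\<beta> \<phi>. binds \<Psi> Y \<beta> \<phi> \<longrightarrow> X \<notin> free_vars \<beta>))"

definition alternation_depth :: "('p, 'v) fm \<Rightarrow> nat set" where
  "alternation_depth \<Psi> = {0 .. (LEAST n. \<exists>\<Omega>. priority_assignment \<Psi> n \<Omega>)}"


section \<open>Tableaus\<close>

text \<open>
  A node is the list of directions leading to it from the root. \<open>Via B \<psi>\<close> leads from a modal node
  to the child given by \<open>\<psi> \<in> B\<close> and the formula \<open>Arrow B\<close> of the label; \<open>Down\<close> leads to the only
  child of a node where a rule with a single conclusion is applied. The active formula of a node is
  the formula acted upon, or \<open>None\<close> if the modal rule is applied.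
\<close>

datatype ('p, 'v) dir = Down | Lft | Rgt | Via "('p, 'v) fm fset" "('p, 'v) fm"

type_synonym ('p, 'v) node = "('p, 'v) dir list"

record ('p, 'v) tableau =
  lab :: "('p, 'v) node \<Rightarrow> ('p, 'v) fm set option"
  active :: "('p, 'v) node \<Rightarrow> ('p, 'v) fm option"
  goal :: "('p, 'v) fm"

definition reducible :: "('p, 'v) fm \<Rightarrow> ('p, 'v) fm \<Rightarrow> bool" where
  "reducible \<Psi> \<alpha> \<longleftrightarrow>
     (\<exists>\<phi> \<psi>. \<alpha> = And \<phi> \<psi>) \<or> (\<exists>\<phi> \<psi>. \<alpha> = Or \<phi> \<psi>) \<or>
     (\<exists>X \<phi>. \<alpha> = Mu X \<phi>) \<or> (\<exists>X \<phi>. \<alpha> = Nu X \<phi>) \<or>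
     (\<exists>X \<in> bound_vars \<Psi>. \<alpha> = Var X)"

definition modal_children ::
  "('p, 'v) fm set \<Rightarrow> ('p, 'v) dir \<Rightarrow> ('p, 'v) fm set option" where
  "modal_children L d =
     (case d of
        Via B \<psi> \<Rightarrow>
          if consistent L \<and> Arrow B \<in> L \<and> \<psi> \<in> fset B
          then Some (insert \<psi> {big_disj B' | B'. Arrow B' \<in> L \<and> B' \<noteq> B})
          else None
      | _ \<Rightarrow> None)"

text \<open>
  \<open>tableau_rule \<Psi> L a ch\<close>: in a tableau of \<open>\<Psi>\<close>, a node with label \<open>L\<close> and active formula \<open>a\<close> may
  have exactly the children with labels \<open>ch\<close>.
\<close>

inductive tableau_rule ::
  "('p, 'v) fm \<Rightarrow> ('p, 'v) fm set \<Rightarrow> ('p, 'v) fm option \<Rightarrow>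
   (('p, 'v) dir \<Rightarrow> ('p, 'v) fm set option) \<Rightarrow> bool" for \<Psi> L where
  conj: "\<alpha> = And \<phi> \<psi> \<Longrightarrow> \<alpha> \<in> L \<Longrightarrow>
     tableau_rule \<Psi> L (Some \<alpha>) [Down \<mapsto> (L - {\<alpha>}) \<union> {\<phi>, \<psi>}]"
| disj: "\<alpha> = Or \<phi> \<psi> \<Longrightarrow> \<alpha> \<in> L \<Longrightarrow>
     tableau_rule \<Psi> L (Some \<alpha>) [Lft \<mapsto> (L - {\<alpha>}) \<union> {\<phi>}, Rgt \<mapsto> (L - {\<alpha>}) \<union> {\<psi>}]"
| fixpoint: "\<alpha> = Mu X \<phi> \<or> \<alpha> = Nu X \<phi> \<Longrightarrow> \<alpha> \<in> L \<Longrightarrow>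
     tableau_rule \<Psi> L (Some \<alpha>) [Down \<mapsto> (L - {\<alpha>}) \<union> {\<phi>}]"
| regeneration: "\<alpha> = Var X \<Longrightarrow> \<alpha> \<in> L \<Longrightarrow> binds \<Psi> X \<beta> \<phi> \<Longrightarrow>
     tableau_rule \<Psi> L (Some \<alpha>) [Down \<mapsto> (L - {\<alpha>}) \<union> {\<phi>}]"
| modal: "(\<And>\<alpha>. \<alpha> \<in> L \<Longrightarrow> \<not> reducible \<Psi> \<alpha>) \<Longrightarrow>
     tableau_rule \<Psi> L None (modal_children L)"

definition is_tableau :: "('p, 'v) tableau \<Rightarrow> bool" where
  "is_tableau T \<longleftrightarrow>
     lab T [] = Some {goal T} \<and>
     (\<forall>v d. lab T v = None \<longrightarrow> lab T (v @ [d]) = None) \<and>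
     (\<forall>v L. lab T v = Some L \<longrightarrow>
        tableau_rule (goal T) L (active T v) (\<lambda>d. lab T (v @ [d])))"

definition tableau_of :: "('p, 'v) tableau \<Rightarrow> ('p, 'v) fm \<Rightarrow> bool" where
  "tableau_of T \<Psi> \<longleftrightarrow> is_tableau T \<and> goal T = \<Psi>"


section \<open>Traces and parity of infinite branches\<close>

text \<open>An infinite branch is given by its directions; \<open>branch_node \<delta> i\<close> is its \<open>i\<close>-th node.\<close>

definition branch_node :: "(nat \<Rightarrow> ('p, 'v) dir) \<Rightarrow> nat \<Rightarrow> ('p, 'v) node" where
  "branch_node \<delta> i = map \<delta> [0..<i]"

definition infinite_branch :: "('p, 'v) tableau \<Rightarrow> (nat \<Rightarrow> ('p, 'v) dir) \<Rightarrow> bool" where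
  "infinite_branch T \<delta> \<longleftrightarrow> (\<forall>i. lab T (branch_node \<delta> i) \<noteq> None)"

inductive trace_step ::
  "('p, 'v) fm \<Rightarrow> ('p, 'v) fm option \<Rightarrow> ('p, 'v) dir \<Rightarrow> ('p, 'v) fm \<Rightarrow> ('p, 'v) fm \<Rightarrow> bool"
  for \<Psi> where
  unchanged: "\<alpha> \<noteq> \<rho> \<Longrightarrow> trace_step \<Psi> (Some \<rho>) d \<alpha> \<alpha>"
| conj_left: "\<alpha> = And \<phi> \<psi> \<Longrightarrow> trace_step \<Psi> (Some \<alpha>) Down \<alpha> \<phi>"
| conj_right: "\<alpha> = And \<phi> \<psi> \<Longrightarrow> trace_step \<Psi> (Some \<alpha>) Down \<alpha> \<psi>"
| disj_left: "\<alpha> = Or \<phi> \<psi> \<Longrightarrow> trace_step \<Psi> (Some \<alpha>) Lft \<alpha> \<phi>"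
| disj_right: "\<alpha> = Or \<phi> \<psi> \<Longrightarrow> trace_step \<Psi> (Some \<alpha>) Rgt \<alpha> \<psi>"
| fixpoint: "\<alpha> = Mu X \<phi> \<or> \<alpha> = Nu X \<phi> \<Longrightarrow> trace_step \<Psi> (Some \<alpha>) Down \<alpha> \<phi>"
| regeneration: "\<alpha> = Var X \<Longrightarrow> binds \<Psi> X \<beta> \<phi> \<Longrightarrow> trace_step \<Psi> (Some \<alpha>) Down \<alpha> \<phi>"
| modal_member: "trace_step \<Psi> None (Via B \<psi>) (Arrow B) \<psi>"
| modal_disj: "B' \<noteq> B \<Longrightarrow> trace_step \<Psi> None (Via B \<psi>) (Arrow B') (big_disj B')"

definition trace :: "('p, 'v) tableau \<Rightarrow> (nat \<Rightarrow> ('p, 'v) dir) \<Rightarrow> (nat \<Rightarrow> ('p, 'v) fm) \<Rightarrow> bool" where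
  "trace T \<delta> \<tau> \<longleftrightarrow>
     (\<forall>i. \<tau> i \<in> the (lab T (branch_node \<delta> i)) \<and>
          trace_step (goal T) (active T (branch_node \<delta> i)) (\<delta> i) (\<tau> i) (\<tau> (Suc i)))"

definition regenerated_inf ::
  "('p, 'v) tableau \<Rightarrow> (nat \<Rightarrow> ('p, 'v) dir) \<Rightarrow> (nat \<Rightarrow> ('p, 'v) fm) \<Rightarrow> 'v set" where
  "regenerated_inf T \<delta> \<tau> =
     {X. \<exists>\<^sub>\<infinity>i. \<tau> i = Var X \<and> active T (branch_node \<delta> i) = Some (Var X)}"

definition mu_trace ::
  "('p, 'v) tableau \<Rightarrow> (nat \<Rightarrow> ('p, 'v) dir) \<Rightarrow> (nat \<Rightarrow> ('p, 'v) fm) \<Rightarrow> bool" where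
  "mu_trace T \<delta> \<tau> \<longleftrightarrow> trace T \<delta> \<tau> \<and>
     (\<exists>X \<phi>. X \<in> regenerated_inf T \<delta> \<tau> \<and> Mu X \<phi> \<in> subfms (goal T) \<and>
        (\<forall>Y \<in> regenerated_inf T \<delta> \<tau>. \<forall>\<beta> \<psi>.
           binds (goal T) Y \<beta> \<psi> \<longrightarrow> \<beta> \<in> subfms (Mu X \<phi>)))"

definition odd_branch :: "('p, 'v) tableau \<Rightarrow> (nat \<Rightarrow> ('p, 'v) dir) \<Rightarrow> bool" where
  "odd_branch T \<delta> \<longleftrightarrow> (\<exists>\<tau>. mu_trace T \<delta> \<tau>)"


section \<open>Tableau cores and their equivalence\<close>

definition modal_node :: "('p, 'v) tableau \<Rightarrow> ('p, 'v) node \<Rightarrow> bool" where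
  "modal_node T v \<longleftrightarrow> lab T v \<noteq> None \<and> active T v = None"

definition disj_node :: "('p, 'v) tableau \<Rightarrow> ('p, 'v) node \<Rightarrow> bool" where
  "disj_node T v \<longleftrightarrow> lab T v \<noteq> None \<and> (\<exists>\<phi> \<psi>. active T v = Some (Or \<phi> \<psi>))"

text \<open>
  The nodes of the core are the modal nodes and, representing each cluster of disjunction steps not
  separated by a modal step, the first disjunction of the cluster.
\<close>

definition core_node :: "('p, 'v) tableau \<Rightarrow> ('p, 'v) node \<Rightarrow> bool" where
  "core_node T v \<longleftrightarrow> modal_node T v \<or>
     disj_node T v \<and>
     \<not> (\<exists>u. disj_node T u \<and> strict_prefix u v \<and>
            (\<forall>w. strict_prefix u w \<and> strict_prefix w v \<longrightarrow> \<not> modal_node T w))"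

definition core_root :: "('p, 'v) tableau \<Rightarrow> ('p, 'v) node \<Rightarrow> bool" where
  "core_root T v \<longleftrightarrow> core_node T v \<and> (\<forall>u. strict_prefix u v \<longrightarrow> \<not> core_node T u)"

definition core_succ :: "('p, 'v) tableau \<Rightarrow> ('p, 'v) node \<Rightarrow> ('p, 'v) node \<Rightarrow> bool" where
  "core_succ T u v \<longleftrightarrow> core_node T u \<and> core_node T v \<and> strict_prefix u v \<and>
     (\<forall>w. strict_prefix u w \<and> strict_prefix w v \<longrightarrow> \<not> core_node T w)"

definition core_path :: "('p, 'v) tableau \<Rightarrow> (nat \<Rightarrow> ('p, 'v) node) \<Rightarrow> bool" where
  "core_path T \<pi> \<longleftrightarrow> core_root T (\<pi> 0) \<and> (\<forall>i. core_succ T (\<pi> i) (\<pi> (Suc i)))"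

text \<open>An infinite path of the core has the parity of the branch on which its nodes lie.\<close>

definition odd_core_path :: "('p, 'v) tableau \<Rightarrow> (nat \<Rightarrow> ('p, 'v) node) \<Rightarrow> bool" where
  "odd_core_path T \<pi> \<longleftrightarrow>
     (\<exists>\<delta>. infinite_branch T \<delta> \<and> range \<pi> \<subseteq> range (branch_node \<delta>) \<and> odd_branch T \<delta>)"

definition node_literals :: "('p, 'v) tableau \<Rightarrow> ('p, 'v) node \<Rightarrow> ('p, 'v) fm set" where
  "node_literals T v = the (lab T v) \<inter> literals"

definition core_bisimulation ::
  "('p, 'v) tableau \<Rightarrow> ('p, 'v) tableau \<Rightarrow> (('p, 'v) node \<Rightarrow> ('p, 'v) node \<Rightarrow> bool) \<Rightarrow> bool" where
  "core_bisimulation T T' Z \<longleftrightarrow>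
     (\<exists>r r'. core_root T r \<and> core_root T' r' \<and> Z r r') \<and>
     (\<forall>v v'. Z v v' \<longrightarrow>
        core_node T v \<and> core_node T' v' \<and>
        (modal_node T v \<longleftrightarrow> modal_node T' v') \<and>
        (modal_node T v \<longrightarrow> node_literals T v = node_literals T' v') \<and>
        (\<forall>w. core_succ T v w \<longrightarrow> (\<exists>w'. core_succ T' v' w' \<and> Z w w')) \<and>
        (\<forall>w'. core_succ T' v' w' \<longrightarrow> (\<exists>w. core_succ T v w \<and> Z w w'))) \<and>
     (\<forall>\<pi> \<pi>'. core_path T \<pi> \<longrightarrow> core_path T' \<pi>' \<longrightarrow> (\<forall>i. Z (\<pi> i) (\<pi>' i)) \<longrightarrow>
        (odd_core_path T \<pi> \<longleftrightarrow> odd_core_path T' \<pi>'))"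

definition tableau_equiv :: "('p, 'v) tableau \<Rightarrow> ('p, 'v) tableau \<Rightarrow> bool" where
  "tableau_equiv T T' \<longleftrightarrow> (\<exists>Z. core_bisimulation T T' Z)"

end

theory Submission
  imports Defs "HOL-Library.Infinite_Set"
begin

text \<open>
  The least priority assignment of a formula gives \<open>X\<close> the largest number \<open>k\<close> that is forced by a
  chain of nested fixpoints of alternating parity ending in \<open>X\<close>. The tableau of a disjunctive formula
  has essentially one trace on every branch, and such a chain is visible in it: any variable of the
  chain is the outermost one on some loop through the bodies of all those below it. The two formulas
  are compared by a play: a branch of the first tableau is chosen step by step, and the second
  tableau follows along the bisimulations. By induction on \<open>k\<close>, the loops can be chosen so that the
  second tableau regenerates a variable of priority at least \<open>k\<close> in any priority assignment: if
  priority \<open>k + 1\<close> could be avoided while the loops forcing \<open>k\<close> and a loop through \<open>X\<close> alternate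
  forever, the two branches would have different parities. So no priority assignment of
  the second formula has fewer priorities than the first formula requires, and vice versa.
\<close>

section \<open>Formulas\<close>

text \<open>The node reached by the second tableau is not determined by the label on the left, so
  the induction on \<open>k\<close> must start from an arbitrary play. It must also yield something
  repeatable: the loop returns to the label from which it started and regenerates only variables
  bound inside the binder of \<open>X\<close>, so that \<open>X\<close> is outermost on an infinite
  concatenation of such loops that keeps regenerating it. Guardedness enters twice. Since the bound
  variable occurs in its body, a loop through \<open>X\<close> exists; since it occurs only under
  modalities, the loop crosses a modal node. Hence each round lengthens the path in the core, and
  infinitely many rounds give an infinite core path, the only kind of object whose parity the
  equivalence compares. On the right only regenerations need to be observed: on a branch of a
  tableau of a disjunctive formula, parity is that of the greatest priority regenerated infinitely
  often, whatever the priority assignment.\<close>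

lemma subfms_refl [simp]: "\<phi> \<in> subfms \<phi>"
  by (cases \<phi>) auto

lemma subfms_mono: "\<psi> \<in> subfms \<phi> \<Longrightarrow> subfms \<psi> \<subseteq> subfms \<phi>"
  by (induction \<phi>) (auto; blast)+

text \<open>Conjunction adds ranks because both conjuncts enter the label together and the sum of
  ranks over a label has to drop. For a modality a maximum is enough, since a label takes one member
  at a time.\<close>

primrec rank :: "('p, 'v) fm \<Rightarrow> nat" where
  "rank Top = 0"
| "rank Bot = 0"
| "rank (Prop p) = 0"
| "rank (NProp p) = 0"
| "rank (Var X) = 0"
| "rank (And \<phi> \<psi>) = Suc (rank \<phi> + rank \<psi>)"
| "rank (Or \<phi> \<psi>) = Suc (rank \<phi> + rank \<psi>)"
| "rank (Arrow B) = Suc (Max (insert 0 (fset (rank |`| B))))"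
| "rank (Mu X \<phi>) = Suc (rank \<phi>)"
| "rank (Nu X \<phi>) = Suc (rank \<phi>)"

lemma rank_Arrow: "\<beta> \<in> fset B \<Longrightarrow> rank \<beta> < rank (Arrow B)"
  by (simp add: less_Suc_eq_le)

lemma subfms_rank: "\<psi> \<in> subfms \<phi> \<Longrightarrow> \<psi> = \<phi> \<or> rank \<psi> < rank \<phi>"
proof (induction \<phi>)
  case (Arrow B)
  then show ?case
    using rank_Arrow[of _ B] by (auto simp del: rank.simps) (metis less_trans)
qed auto

lemma bound_vars_simps [simp]:
  "bound_vars Top = {}" "bound_vars Bot = {}" "bound_vars (Prop p) = {}"
  "bound_vars (NProp p) = {}" "bound_vars (Var X) = {}"
  "bound_vars (And \<phi> \<psi>) = bound_vars \<phi> \<union> bound_vars \<psi>"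
  "bound_vars (Or \<phi> \<psi>) = bound_vars \<phi> \<union> bound_vars \<psi>"
  "bound_vars (Arrow B) = (\<Union>\<beta> \<in> fset B. bound_vars \<beta>)"
  "bound_vars (Mu X \<phi>) = insert X (bound_vars \<phi>)"
  "bound_vars (Nu X \<phi>) = insert X (bound_vars \<phi>)"
  unfolding bound_vars_def mu_bound_def nu_bound_def by auto

lemma Var_subfms: "Var X \<in> subfms \<phi> \<Longrightarrow> X \<in> free_vars \<phi> \<or> X \<in> bound_vars \<phi>"
  by (induction \<phi>) auto

lemma bindsD: "binds \<Psi> X \<beta> \<phi> \<Longrightarrow> \<beta> \<in> subfms \<Psi> \<and> \<phi> \<in> subfms \<Psi> \<and> \<phi> \<in> subfms \<beta> \<and> X \<in> bound_vars \<Psi>"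
  unfolding binds_def bound_vars_def mu_bound_def nu_bound_def
  using subfms_mono by fastforce

lemma bound_vars_binds: "X \<in> bound_vars \<Psi> \<longleftrightarrow> (\<exists>\<beta> \<phi>. binds \<Psi> X \<beta> \<phi>)"
  unfolding binds_def bound_vars_def mu_bound_def nu_bound_def by auto

lemma binds_subfms: "binds \<Psi> X \<beta> \<phi> \<Longrightarrow> \<Psi> \<in> subfms \<Psi>' \<Longrightarrow> binds \<Psi>' X \<beta> \<phi>"
  unfolding binds_def using subfms_mono by blast

lemma bound_vars_mono: "\<psi> \<in> subfms \<phi> \<Longrightarrow> bound_vars \<psi> \<subseteq> bound_vars \<phi>"
  using binds_subfms by (fastforce simp: bound_vars_binds)

lemma finite_bound_vars: "finite (bound_vars \<Psi>)"
  by (induction \<Psi>) auto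

lemma binds_direct: "binds (Mu X \<phi>) X (Mu X \<phi>) \<phi>" "binds (Nu X \<phi>) X (Nu X \<phi>) \<phi>"
  unfolding binds_def by auto

text \<open>On the way out from \<open>\<beta>\<close> to \<open>\<Psi>\<close>, the variable can
  stop being free only at one of its binders.\<close>

lemma free_var_binder_above:
  assumes "\<beta> \<in> subfms \<Psi>" "X \<in> free_vars \<beta>" "X \<notin> free_vars \<Psi>"
  shows "\<exists>\<gamma> \<phi>. binds \<Psi> X \<gamma> \<phi> \<and> \<beta> \<in> subfms \<phi>"
  using assms
proof (induction \<Psi>)
  case (And \<phi> \<psi>)
  then have "\<beta> \<in> subfms \<phi> \<or> \<beta> \<in> subfms \<psi>" by auto
  moreover have "\<phi> \<in> subfms (And \<phi> \<psi>)" "\<psi> \<in> subfms (And \<phi> \<psi>)" by auto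
  ultimately show ?case using And binds_subfms[of _ X _ _ "And \<phi> \<psi>"] by (metis UnCI free_vars.simps(6))
next
  case (Or \<phi> \<psi>)
  then have "\<beta> \<in> subfms \<phi> \<or> \<beta> \<in> subfms \<psi>" by auto
  moreover have "\<phi> \<in> subfms (Or \<phi> \<psi>)" "\<psi> \<in> subfms (Or \<phi> \<psi>)" by auto
  ultimately show ?case using Or binds_subfms[of _ X _ _ "Or \<phi> \<psi>"] by (metis UnCI free_vars.simps(7))
next
  case (Arrow B)
  then obtain \<delta> where \<delta>: "\<delta> \<in> fset B" "\<beta> \<in> subfms \<delta>" by auto
  with Arrow obtain \<gamma> \<phi> where "binds \<delta> X \<gamma> \<phi>" "\<beta> \<in> subfms \<phi>" by force
  then show ?case using \<delta>(1) binds_subfms[of \<delta> X \<gamma> \<phi> "Arrow B"] by force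
next
  case (Mu Y \<psi>)
  show ?case
  proof (cases "X \<in> free_vars \<psi>")
    case True
    then show ?thesis using Mu binds_direct(1)[of Y \<psi>] by auto
  next
    case False
    then obtain \<gamma> \<phi> where "binds \<psi> X \<gamma> \<phi>" "\<beta> \<in> subfms \<phi>" using Mu by auto
    then show ?thesis using binds_subfms[of \<psi> X \<gamma> \<phi> "Mu Y \<psi>"] by force
  qed
next
  case (Nu Y \<psi>)
  show ?case
  proof (cases "X \<in> free_vars \<psi>")
    case True
    then show ?thesis using Nu binds_direct(2)[of Y \<psi>] by auto
  next
    case False
    then obtain \<gamma> \<phi> where "binds \<psi> X \<gamma> \<phi>" "\<beta> \<in> subfms \<phi>" using Nu by auto
    then show ?thesis using binds_subfms[of \<psi> X \<gamma> \<phi> "Nu Y \<psi>"] by force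
  qed
qed auto

lemma well_named_unique:
  assumes "well_named \<Psi>" "binds \<Psi> X \<beta> \<phi>" "binds \<Psi> X \<beta>' \<phi>'"
  shows "\<beta> = \<beta>' \<and> \<phi> = \<phi>'"
  using assms unfolding well_named_def binds_def by blast

lemma well_named_no_free:
  "well_named \<Psi> \<Longrightarrow> X \<in> bound_vars \<Psi> \<Longrightarrow> X \<notin> free_vars \<Psi>"
  unfolding well_named_def by auto

lemma well_named_mu_nu:
  "well_named \<Psi> \<Longrightarrow> X \<in> mu_bound \<Psi> \<Longrightarrow> X \<notin> nu_bound \<Psi>"
  unfolding well_named_def binds_def mu_bound_def nu_bound_def by fast

section \<open>Forced levels and the least priority assignment\<close>

text \<open>\<open>depends \<Psi> Z X\<close>: \<open>X\<close> is at least as significant as \<open>Z\<close>, so its priority is at least that of \<open>Z\<close>.\<close>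

definition depends :: "('p, 'v) fm \<Rightarrow> 'v \<Rightarrow> 'v \<Rightarrow> bool" where
  "depends \<Psi> Z X \<longleftrightarrow> X \<in> bound_vars \<Psi> \<and> (\<exists>\<beta> \<phi>. binds \<Psi> Z \<beta> \<phi> \<and> X \<in> free_vars \<beta>)"

text \<open>The binder of \<open>X\<close> that must lie above \<open>\<beta>\<close> is the only
  one there is. So dependence is strict nesting of binders, which makes it well-founded.\<close>

lemma depends_nested:
  assumes "well_named \<Psi>" "depends \<Psi> Z X" "binds \<Psi> Z \<beta> \<phi>" "binds \<Psi> X \<gamma> \<psi>"
  shows "\<beta> \<in> subfms \<psi>" "X \<in> free_vars \<beta>" "rank \<beta> < rank \<gamma>"
proof -
  show free: "X \<in> free_vars \<beta>"
    using assms(2,3) well_named_unique[OF assms(1)] unfolding depends_def by blast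
  show sub: "\<beta> \<in> subfms \<psi>"
    using free_var_binder_above[of \<beta> \<Psi> X] free bindsD[OF assms(3)] bindsD[OF assms(4)]
      well_named_no_free[OF assms(1)] well_named_unique[OF assms(1) assms(4)] by blast
  show "rank \<beta> < rank \<gamma>"
    using subfms_rank[OF sub] assms(4) unfolding binds_def by auto
qed

lemma priority_assignment_depends:
  "priority_assignment \<Psi> n \<Omega> \<Longrightarrow> depends \<Psi> Z X \<Longrightarrow> \<Omega> Z \<le> \<Omega> X"
  unfolding priority_assignment_def depends_def
  by (meson bindsD not_le)

text \<open>\<open>forced \<Psi> k X\<close>: every priority assignment gives \<open>X\<close> a priority of at least \<open>k\<close>.\<close>

inductive forced :: "('p, 'v) fm \<Rightarrow> nat \<Rightarrow> 'v \<Rightarrow> bool" for \<Psi> where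
  zero: "X \<in> bound_vars \<Psi> \<Longrightarrow> forced \<Psi> 0 X"
| depends: "forced \<Psi> k Z \<Longrightarrow> depends \<Psi> Z X \<Longrightarrow> forced \<Psi> k X"
| parity: "forced \<Psi> k X \<Longrightarrow> odd k \<noteq> (X \<in> mu_bound \<Psi>) \<Longrightarrow> forced \<Psi> (Suc k) X"

lemma forced_bound_vars: "forced \<Psi> k X \<Longrightarrow> X \<in> bound_vars \<Psi>"
  by (induction rule: forced.induct) (auto simp: depends_def)

text \<open>A level gained by the rule \<open>parity\<close> matches the type of \<open>X\<close>; a
  positive level that does not match is therefore inherited from a variable below.\<close>

lemma forced_parity:
  "forced \<Psi> k X \<Longrightarrow>
    k = 0 \<or> odd k = (X \<in> mu_bound \<Psi>) \<or> (\<exists>Z. forced \<Psi> k Z \<and> depends \<Psi> Z X)"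
  by (cases rule: forced.cases) auto

definition binder_rank :: "('p, 'v) fm \<Rightarrow> 'v \<Rightarrow> nat" where
  "binder_rank \<Psi> X = rank (SOME \<beta>. \<exists>\<phi>. binds \<Psi> X \<beta> \<phi>)"

lemma binder_rank_eq: "well_named \<Psi> \<Longrightarrow> binds \<Psi> X \<beta> \<phi> \<Longrightarrow> binder_rank \<Psi> X = rank \<beta>"
  unfolding binder_rank_def by (metis (mono_tags, lifting) well_named_unique)

lemma depends_binder_rank:
  assumes "well_named \<Psi>" "depends \<Psi> Z X"
  shows "binder_rank \<Psi> Z < binder_rank \<Psi> X"
  using depends_nested(3)[OF assms] binder_rank_eq[OF assms(1)] assms(2)
  unfolding depends_def bound_vars_binds by metis

text \<open>The slack of 1 is granted only when \<open>k\<close> has the parity of \<open>X\<close>.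
  The rule \<open>parity\<close> spends it; \<open>depends\<close> regains it, since the binder rank
  grows by at least one and the factor 2 turns this into two levels. The bound serves to make the
  set of forced levels finite.\<close>

lemma forced_bound:
  assumes "well_named \<Psi>"
  shows "forced \<Psi> k X \<Longrightarrow>
    k \<le> 2 * binder_rank \<Psi> X + (if odd k = (X \<in> mu_bound \<Psi>) then 1 else 0)"
proof (induction rule: forced.induct)
  case (depends k Z X)
  have "k \<le> 2 * binder_rank \<Psi> Z + 1" using depends.IH by (simp split: if_splits)
  then show ?case using depends_binder_rank[OF assms depends.hyps(2)] by simp
next
  case (parity k X)
  then have "k \<le> 2 * binder_rank \<Psi> X" by simp
  then show ?case using parity.hyps(2) by simp
qed simp

definition least_priority :: "('p, 'v) fm \<Rightarrow> 'v \<Rightarrow> nat" where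
  "least_priority \<Psi> X = Max {k. forced \<Psi> k X}"

lemma finite_forced:
  assumes "well_named \<Psi>"
  shows "finite {k. forced \<Psi> k X}"
proof (rule finite_subset)
  show "{k. forced \<Psi> k X} \<subseteq> {..2 * binder_rank \<Psi> X + 1}"
  proof
    fix k assume "k \<in> {k. forced \<Psi> k X}"
    with forced_bound[OF assms, of k X] show "k \<in> {..2 * binder_rank \<Psi> X + 1}"
      by (simp split: if_splits)
  qed
qed simp

lemma forced_least_priority:
  assumes "well_named \<Psi>" "X \<in> bound_vars \<Psi>"
  shows "forced \<Psi> (least_priority \<Psi> X) X"
proof -
  have "{k. forced \<Psi> k X} \<noteq> {}"
    using forced.zero[OF assms(2)] by (metis empty_iff mem_Collect_eq)
  from Max_in[OF finite_forced[OF assms(1)] this] show ?thesis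
    unfolding least_priority_def by simp
qed

lemma forced_le:
  assumes "well_named \<Psi>" "forced \<Psi> k X"
  shows "k \<le> least_priority \<Psi> X"
  unfolding least_priority_def using assms(2) by (intro Max_ge[OF finite_forced[OF assms(1)]]) simp

lemma least_priority_parity:
  assumes "well_named \<Psi>" "X \<in> bound_vars \<Psi>"
  shows "odd (least_priority \<Psi> X) = (X \<in> mu_bound \<Psi>)"
proof (rule ccontr)
  assume "odd (least_priority \<Psi> X) \<noteq> (X \<in> mu_bound \<Psi>)"
  from forced_le[OF assms(1) forced.parity[OF forced_least_priority[OF assms] this]]
  show False by simp
qed

text \<open>Take \<open>Y\<close> innermost among the variables of level at least \<open>j\<close>.
  Nothing of level at least \<open>j\<close> lies below it, so a level beyond \<open>j\<close> at
  \<open>Y\<close> would come by \<open>parity\<close> from some \<open>k\<close> of the wrong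
  parity with \<open>j \<le> k\<close>, and that level would have to be inherited from
  below.\<close>

lemma least_priority_attained:
  assumes wn: "well_named \<Psi>" and X: "X \<in> bound_vars \<Psi>" and j: "1 \<le> j" "j \<le> least_priority \<Psi> X"
  shows "\<exists>Y \<in> bound_vars \<Psi>. least_priority \<Psi> Y = j"
proof -
  let ?P = "\<lambda>Y. Y \<in> bound_vars \<Psi> \<and> j \<le> least_priority \<Psi> Y"
  obtain Y where Y: "?P Y" and min: "\<And>Z. ?P Z \<Longrightarrow> binder_rank \<Psi> Y \<le> binder_rank \<Psi> Z"
    using ex_has_least_nat[of ?P X "binder_rank \<Psi>"] X j by blast
  have no_dep: "\<not> (forced \<Psi> k Z \<and> depends \<Psi> Z Y)" if "j \<le> k" for k Z
  proof
    assume Z: "forced \<Psi> k Z \<and> depends \<Psi> Z Y"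
    then have "?P Z" using forced_le[OF wn, of k Z] forced_bound_vars[of \<Psi> k Z] that by auto
    from min[OF this] show False using depends_binder_rank[OF wn, of Z Y] Z by auto
  qed
  have "least_priority \<Psi> Y = j"
  proof (rule ccontr)
    assume "least_priority \<Psi> Y \<noteq> j"
    then obtain k where k: "least_priority \<Psi> Y = Suc k" "j \<le> k"
      using Y by (cases "least_priority \<Psi> Y") auto
    from forced_least_priority[OF wn, of Y] Y k(1) have "forced \<Psi> (Suc k) Y" by simp
    then have *: "forced \<Psi> k Y" "odd k \<noteq> (Y \<in> mu_bound \<Psi>)"
      using no_dep[of "Suc k"] k(2) by (auto elim: forced.cases)
    from forced_parity[OF *(1)] show False using no_dep[OF k(2)] j(1) k(2) *(2) by auto
  qed
  with Y show ?thesis by blast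
qed

definition max_priority :: "('p, 'v) fm \<Rightarrow> nat" where
  "max_priority \<Psi> = Max (insert 0 (least_priority \<Psi> ` bound_vars \<Psi>))"

lemma least_priority_assignment:
  assumes "well_named \<Psi>"
  shows "priority_assignment \<Psi> (max_priority \<Psi>) (least_priority \<Psi>)"
proof -
  have le: "least_priority \<Psi> X \<le> max_priority \<Psi>" if "X \<in> bound_vars \<Psi>" for X
    unfolding max_priority_def using that finite_bound_vars by (intro Max_ge) auto
  have attained: "\<exists>X \<in> bound_vars \<Psi>. least_priority \<Psi> X = j" if "j \<in> {1..max_priority \<Psi>}" for j
  proof -
    have "max_priority \<Psi> \<in> insert 0 (least_priority \<Psi> ` bound_vars \<Psi>)"
      unfolding max_priority_def using finite_bound_vars by (intro Max_in) auto
    then show ?thesis using that least_priority_attained[OF assms] by auto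
  qed
  have "X \<notin> free_vars \<beta>"
    if "X \<in> bound_vars \<Psi>" "least_priority \<Psi> X < least_priority \<Psi> Y" "binds \<Psi> Y \<beta> \<phi>"
    for X Y \<beta> \<phi>
  proof
    assume "X \<in> free_vars \<beta>"
    with that have "depends \<Psi> Y X" unfolding depends_def by blast
    from forced.depends[OF forced_least_priority this] forced_le[OF assms, of _ X]
      assms bindsD[OF that(3)] that(2)
    show False by (meson not_le)
  qed
  moreover have "odd (least_priority \<Psi> X)" if "X \<in> mu_bound \<Psi>" for X
    using that least_priority_parity[OF assms, of X] unfolding bound_vars_def by auto
  moreover have "even (least_priority \<Psi> X)" if "X \<in> nu_bound \<Psi>" for X
    using that least_priority_parity[OF assms, of X] well_named_mu_nu[OF assms, of X]
    unfolding bound_vars_def by auto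
  moreover have "least_priority \<Psi> ` bound_vars \<Psi> \<subseteq> {0..max_priority \<Psi>}"
    using le by auto
  moreover have "{1..max_priority \<Psi>} \<subseteq> least_priority \<Psi> ` bound_vars \<Psi>"
  proof
    fix j assume "j \<in> {1..max_priority \<Psi>}"
    from attained[OF this] show "j \<in> least_priority \<Psi> ` bound_vars \<Psi>" by blast
  qed
  ultimately show ?thesis
    unfolding priority_assignment_def by blast
qed

lemma forced_max_priority:
  assumes "well_named \<Psi>" "max_priority \<Psi> \<noteq> 0"
  shows "\<exists>X. forced \<Psi> (max_priority \<Psi>) X"
proof -
  have "max_priority \<Psi> \<in> insert 0 (least_priority \<Psi> ` bound_vars \<Psi>)"
    unfolding max_priority_def using finite_bound_vars by (intro Max_in) auto
  then obtain X where "X \<in> bound_vars \<Psi>" "max_priority \<Psi> = least_priority \<Psi> X"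
    using assms(2) by auto
  then show ?thesis using forced_least_priority[OF assms(1), of X] by auto
qed

text \<open>This reduces the theorem to a transfer: a level forced in one formula must fit into
  every priority assignment of the other. The transfer is applied to the top level of the least
  priority assignment of \<open>\<phi>\<close>, which is forced.\<close>

lemma alternation_depth_le:
  assumes "well_named \<phi>" "well_named \<psi>"
    and "\<And>k X n \<Omega>. forced \<phi> k X \<Longrightarrow> priority_assignment \<psi> n \<Omega> \<Longrightarrow> k \<le> n"
  shows "(LEAST n. \<exists>\<Omega>. priority_assignment \<phi> n \<Omega>) \<le> (LEAST n. \<exists>\<Omega>. priority_assignment \<psi> n \<Omega>)"
proof -
  obtain \<Omega> where \<Omega>: "priority_assignment \<psi> (LEAST n. \<exists>\<Omega>. priority_assignment \<psi> n \<Omega>) \<Omega>"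
    using LeastI_ex[of "\<lambda>n. \<exists>\<Omega>. priority_assignment \<psi> n \<Omega>"] least_priority_assignment[OF assms(2)]
    by blast
  have "(LEAST n. \<exists>\<Omega>. priority_assignment \<phi> n \<Omega>) \<le> max_priority \<phi>"
    using least_priority_assignment[OF assms(1)] by (auto intro: Least_le)
  also have "\<dots> \<le> (LEAST n. \<exists>\<Omega>. priority_assignment \<psi> n \<Omega>)"
    using forced_max_priority[OF assms(1)] assms(3)[OF _ \<Omega>] by (cases "max_priority \<phi> = 0") auto
  finally show ?thesis .
qed

section \<open>Tableaus of disjunctive formulas\<close>

lemma literals_not_compound [simp]:
  "And \<phi> \<psi> \<notin> literals" "Or \<phi> \<psi> \<notin> literals" "Arrow B \<notin> literals" "Mu X \<phi> \<notin> literals"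
  "Nu X \<phi> \<notin> literals" "Var X \<notin> literals" "Bot \<notin> literals" "Top \<notin> literals"
  unfolding literals_def by auto

lemma conj_list_cases:
  assumes "set bs \<subseteq> literals"
  shows "conj_list bs = Top \<or> conj_list bs \<in> set bs \<or>
    (\<exists>x y zs. bs = x # y # zs \<and> conj_list bs = And x (conj_list (y # zs)))"
  using assms by (cases bs rule: conj_list.cases) auto

text \<open>
  The labels below \<open>\<And>as \<and> \<rightarrow>B\<close> and above the next modal node: \<open>\<rightarrow>B\<close> together with
  partially decomposed conjunctions of literals.
\<close>

definition premodal :: "('p, 'v) fm list \<Rightarrow> ('p, 'v) fm fset \<Rightarrow> ('p, 'v) fm set \<Rightarrow> bool" where
  "premodal as B L \<longleftrightarrow> set as \<subseteq> literals \<and> finite L \<and> Arrow B \<in> L \<and>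
     (\<forall>\<alpha> \<in> L. \<alpha> = Arrow B \<or> (\<exists>bs. set bs \<subseteq> set as \<and> \<alpha> = conj_list bs))"

lemma premodal_single: "premodal [] B {Arrow B}"
  unfolding premodal_def by auto

lemma premodal_conj: "set as \<subseteq> literals \<Longrightarrow> premodal as B {conj_list as, Arrow B}"
  unfolding premodal_def by auto

lemma premodal_mem:
  assumes "premodal as B L" "\<alpha> \<in> L"
  shows "\<alpha> = Arrow B \<or> \<alpha> = Top \<or> \<alpha> \<in> set as \<inter> literals \<or>
    (\<exists>x y zs. set (x # y # zs) \<subseteq> set as \<and> \<alpha> = And x (conj_list (y # zs)))"
proof (cases "\<alpha> = Arrow B")
  case False
  with assms obtain bs where "set bs \<subseteq> set as" "\<alpha> = conj_list bs" "set bs \<subseteq> literals"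
    unfolding premodal_def by blast
  then show ?thesis using conj_list_cases[of bs] by blast
qed simp

lemma premodal_Arrow: "premodal as B L \<Longrightarrow> Arrow B' \<in> L \<Longrightarrow> B' = B"
  using premodal_mem[of as B L "Arrow B'"] by auto

lemma premodal_step:
  assumes "premodal as B L" "And \<phi> \<psi> \<in> L"
  shows "premodal as B (L - {And \<phi> \<psi>} \<union> {\<phi>, \<psi>})"
proof -
  obtain x y zs where *: "set (x # y # zs) \<subseteq> set as" "\<phi> = x" "\<psi> = conj_list (y # zs)"
    using premodal_mem[OF assms] by auto
  then have "set [x] \<subseteq> set as \<and> \<phi> = conj_list [x]" "set (y # zs) \<subseteq> set as \<and> \<psi> = conj_list (y # zs)"
    by auto
  then have "\<exists>bs. set bs \<subseteq> set as \<and> \<alpha> = conj_list bs" if "\<alpha> \<in> {\<phi>, \<psi>}" for \<alpha>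
    using that by blast
  then show ?thesis using assms unfolding premodal_def by auto
qed

lemma premodal_consistent:
  assumes "premodal as B L" "consistent (set as)"
  shows "consistent L"
  unfolding consistent_def
proof (intro conjI notI)
  show False if "Bot \<in> L"
    using premodal_mem[OF assms(1) that] assms(2) unfolding consistent_def by auto
  show False if "\<exists>p. Prop p \<in> L \<and> NProp p \<in> L"
  proof -
    from that obtain p where p: "Prop p \<in> L" "NProp p \<in> L" by blast
    show False using premodal_mem[OF assms(1) p(1)] premodal_mem[OF assms(1) p(2)] assms(2)
      unfolding consistent_def by auto
  qed
qed

text \<open>There is only one modality in the label, so no \<open>big_disj\<close> joins the chosen
  member. This is how labels become singletons again after every modal step.\<close>

lemma modal_children_premodal:
  assumes "premodal as B L" "modal_children L d = Some L'"
  obtains \<psi> where "d = Via B \<psi>" "\<psi> \<in> fset B" "L' = {\<psi>}"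
proof -
  from assms(2) obtain B' \<psi> where *: "d = Via B' \<psi>" "Arrow B' \<in> L" "\<psi> \<in> fset B'"
    "L' = insert \<psi> {big_disj B'' | B''. Arrow B'' \<in> L \<and> B'' \<noteq> B'}"
    unfolding modal_children_def by (auto split: dir.splits if_splits)
  then show ?thesis using that[of \<psi>] premodal_Arrow[OF assms(1)] by auto
qed

lemma modal_children_consistent:
  assumes "premodal as B L" "consistent L" "\<psi> \<in> fset B"
  shows "modal_children L (Via B \<psi>) = Some {\<psi>}"
proof -
  have "Arrow B \<in> L" using assms(1) unfolding premodal_def by blast
  moreover have "{big_disj B' | B'. Arrow B' \<in> L \<and> B' \<noteq> B} = {}"
    using premodal_Arrow[OF assms(1)] by blast
  ultimately show ?thesis
    by (simp only: modal_children_def dir.case assms(2,3) if_True simp_thms)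
qed

inductive_cases disjunctive_AndE: "disjunctive (And \<phi> \<psi>)"
inductive_cases disjunctive_OrE: "disjunctive (Or \<phi> \<psi>)"
inductive_cases disjunctive_MuE: "disjunctive (Mu X \<phi>)"
inductive_cases disjunctive_NuE: "disjunctive (Nu X \<phi>)"
inductive_cases disjunctive_ArrowE: "disjunctive (Arrow B)"

lemma disjunctiveD:
  "disjunctive (And \<phi> \<psi>) \<Longrightarrow> \<exists>as B. set as \<subseteq> literals \<and> \<phi> = conj_list as \<and> \<psi> = Arrow B \<and> disjunctive \<psi>"
  "disjunctive (Or \<phi> \<psi>) \<Longrightarrow> disjunctive \<phi> \<and> disjunctive \<psi>"
  "disjunctive (Mu X \<phi>) \<Longrightarrow> disjunctive \<phi>"
  "disjunctive (Nu X \<phi>) \<Longrightarrow> disjunctive \<phi>"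
  "disjunctive (Arrow B) \<Longrightarrow> \<beta> \<in> fset B \<Longrightarrow> disjunctive \<beta>"
  by (blast elim: disjunctive_AndE disjunctive_OrE disjunctive_MuE disjunctive_NuE
      disjunctive_ArrowE intro: disjunctive.intros dest: literals_not_compound[THEN notE])+

text \<open>
  In a label of a tableau of a disjunctive formula, only one formula, the main formula \<open>m\<close>, can carry
  an infinite trace.
\<close>

definition main_formula :: "('p, 'v) fm \<Rightarrow> ('p, 'v) fm \<Rightarrow> ('p, 'v) fm set \<Rightarrow> bool" where
  "main_formula \<Psi> m L \<longleftrightarrow> m \<in> subfms \<Psi> \<and> disjunctive m \<and>
     (L = {m} \<or> (\<exists>as B. m = Arrow B \<and> premodal as B L))"

lemma main_formula_finite: "main_formula \<Psi> m L \<Longrightarrow> finite L"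
  unfolding main_formula_def premodal_def by auto

text \<open>Disjunctions, fixpoints and variables never occur in a \<open>premodal\<close> label, so
  a rule acting on one of them meets a singleton.\<close>

lemma main_formula_active:
  assumes "main_formula \<Psi> m L" "\<alpha> \<in> L"
    and "\<And>\<phi> \<psi>. \<alpha> \<noteq> And \<phi> \<psi>" "\<And>B. \<alpha> \<noteq> Arrow B" "\<alpha> \<noteq> Top" "\<alpha> \<notin> literals"
  shows "L = {m}" "m = \<alpha>"
proof -
  have "\<not> premodal as B L" for as B
    using premodal_mem[of as B L \<alpha>] assms(2-) by blast
  then show "L = {m}" using assms(1) unfolding main_formula_def by blast
  with assms(2) show "m = \<alpha>" by simp
qed

lemma subfms_children:
  "And \<phi> \<psi> \<in> subfms \<Psi> \<Longrightarrow> \<phi> \<in> subfms \<Psi> \<and> \<psi> \<in> subfms \<Psi>"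
  "Or \<phi> \<psi> \<in> subfms \<Psi> \<Longrightarrow> \<phi> \<in> subfms \<Psi> \<and> \<psi> \<in> subfms \<Psi>"
  "Mu X \<phi> \<in> subfms \<Psi> \<Longrightarrow> \<phi> \<in> subfms \<Psi>"
  "Nu X \<phi> \<in> subfms \<Psi> \<Longrightarrow> \<phi> \<in> subfms \<Psi>"
  "Arrow B \<in> subfms \<Psi> \<Longrightarrow> \<beta> \<in> fset B \<Longrightarrow> \<beta> \<in> subfms \<Psi>"
  by (use subfms_mono in force)+

lemma sum_replace_less:
  fixes f :: "'a \<Rightarrow> nat"
  assumes "finite L" "\<alpha> \<in> L" "finite C" "sum f C < f \<alpha>"
  shows "sum f (L - {\<alpha>} \<union> C) < sum f L"
proof -
  have "sum f (L - {\<alpha>} \<union> C) \<le> sum f (L - {\<alpha>}) + sum f C"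
    using assms(1,3) by (simp add: sum_Un_nat)
  also have "\<dots> < sum f (L - {\<alpha>}) + f \<alpha>" using assms(4) by simp
  also have "\<dots> = sum f L" using sum.remove[OF assms(1,2), of f] by simp
  finally show ?thesis .
qed

lemma disjunctive_subfms_body:
  assumes "\<phi> \<in> subfms \<Psi>" "disjunctive \<Psi>"
  shows "disjunctive \<phi> \<or> (\<exists>as. set as \<subseteq> literals \<and> \<phi> = conj_list as)"
  using assms
proof (induction \<Psi>)
  case (And a b)
  from disjunctiveD(1)[OF And.prems(2)] obtain as B
    where "set as \<subseteq> literals" "a = conj_list as" "b = Arrow B" "disjunctive b" by blast
  moreover have "\<exists>cs. set cs \<subseteq> literals \<and> \<phi> = conj_list cs" if "\<phi> \<in> subfms (conj_list as)"
    using that \<open>set as \<subseteq> literals\<close>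
  proof (induction as rule: conj_list.induct)
    case 1
    then show ?case by (intro exI[of _ "[]"]) auto
  next
    case (2 x)
    then show ?case by (intro exI[of _ "[x]"]) (auto simp: literals_def)
  next
    case (3 x y zs)
    then consider "\<phi> = conj_list (x # y # zs)" | "\<phi> \<in> subfms x" | "\<phi> \<in> subfms (conj_list (y # zs))"
      by auto
    then show ?case
    proof cases
      case 1
      then show ?thesis using 3(3) by blast
    next
      case 2
      then show ?thesis using 3(3) by (intro exI[of _ "[x]"]) (auto simp: literals_def)
    next
      case x: 3
      then show ?thesis using 3 by auto
    qed
  qed
  ultimately show ?case using And by auto
next
  case (Or a b)
  then show ?case using disjunctiveD(2)[OF Or.prems(2)] by auto
next
  case (Arrow B)
  then show ?case using disjunctiveD(5)[OF Arrow.prems(2)] by auto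
next
  case (Mu X a)
  then show ?case using disjunctiveD(3)[OF Mu.prems(2)] by auto
next
  case (Nu X a)
  then show ?case using disjunctiveD(4)[OF Nu.prems(2)] by auto
qed auto

lemma binds_disjunctive:
  assumes "disjunctive \<Psi>" "binds \<Psi> X \<beta> \<phi>"
  shows "disjunctive \<beta> \<and> disjunctive \<phi>"
proof -
  have "\<beta> \<noteq> conj_list as" if "set as \<subseteq> literals" for as
    using conj_list_cases[OF that] that assms(2) unfolding binds_def by auto
  then have "disjunctive \<beta>"
    using disjunctive_subfms_body[of \<beta> \<Psi>] assms unfolding binds_def by blast
  then show ?thesis using assms(2) disjunctiveD(3)[of X \<phi>] disjunctiveD(4)[of X \<phi>]
    unfolding binds_def by auto
qed

text \<open>Regeneration is the only step that can lead out of the subformulas of \<open>m\<close>.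
  All other steps lower the sum of ranks of the label, which later forces infinitely many
  regenerations on an infinite branch.\<close>

lemma main_formula_step:
  assumes \<Psi>: "disjunctive \<Psi>" and m: "main_formula \<Psi> m L"
    and rule: "tableau_rule \<Psi> L a ch" and ch: "ch d = Some L'"
  shows "\<exists>m'. main_formula \<Psi> m' L' \<and> trace_step \<Psi> a d m m' \<and>
    (if \<exists>X. a = Some (Var X) then \<exists>X \<beta>. a = Some (Var X) \<and> m = Var X \<and> L = {m} \<and> binds \<Psi> X \<beta> m'
     else m' \<in> subfms m \<and> sum rank L' < sum rank L)"
  using rule
proof cases
  case (conj \<alpha> \<phi> \<psi>)
  then have L': "d = Down" "L' = L - {\<alpha>} \<union> {\<phi>, \<psi>}"
    using ch by (auto split: if_splits)
  have less: "sum rank L' < sum rank L"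
    unfolding L'(2) by (rule sum_replace_less[OF main_formula_finite[OF m] conj(4)])
      (use conj(3) in \<open>auto simp: sum.insert_if\<close>)
  show ?thesis
  proof (cases "L = {m}")
    case True
    then have "m = And \<phi> \<psi>" using conj by auto
    then obtain as B where *: "set as \<subseteq> literals" "\<phi> = conj_list as" "\<psi> = Arrow B" "disjunctive \<psi>"
      using m disjunctiveD(1) unfolding main_formula_def by blast
    have "L' = {conj_list as, Arrow B}" using L' True conj(3,4) * by simp
    \<comment> \<open>The trace moves on to the modality, because the literals beside it do not
      survive the next modal step.\<close>
    then have "main_formula \<Psi> \<psi> L'"
      using m \<open>m = And \<phi> \<psi>\<close> * premodal_conj[OF *(1), of B] subfms_children(1)[of \<phi> \<psi> \<Psi>]
      unfolding main_formula_def by metis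
    then show ?thesis using less conj L'(1) \<open>m = And \<phi> \<psi>\<close> trace_step.conj_right[of \<alpha> \<phi> \<psi> \<Psi>] by auto
  next
    case False
    then obtain as B where *: "m = Arrow B" "premodal as B L" using m unfolding main_formula_def by blast
    then have "main_formula \<Psi> m L'"
      using premodal_step[of as B L \<phi> \<psi>] m L' conj unfolding main_formula_def by blast
    then show ?thesis using less conj * trace_step.unchanged[of m \<alpha> \<Psi> d] by auto
  qed
next
  case (disj \<alpha> \<phi> \<psi>)
  have sing: "L = {m}" "m = Or \<phi> \<psi>"
    using main_formula_active[OF m, of \<alpha>] disj by auto
  then have "d = Lft \<and> L' = {\<phi>} \<or> d = Rgt \<and> L' = {\<psi>}"
    using ch disj by (auto split: if_splits)
  then show ?thesis
    using m sing disj disjunctiveD(2)[of \<phi> \<psi>] subfms_children(2)[of \<phi> \<psi> \<Psi>]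
      trace_step.disj_left[of m \<phi> \<psi> \<Psi>] trace_step.disj_right[of m \<phi> \<psi> \<Psi>]
    unfolding main_formula_def by auto
next
  case (fixpoint \<alpha> X \<phi>)
  have sing: "L = {m}" "m = \<alpha>"
    using main_formula_active[OF m, of \<alpha>] fixpoint by auto
  then have "d = Down" "L' = {\<phi>}"
    using ch fixpoint by (auto split: if_splits)
  then show ?thesis
    using m sing fixpoint disjunctiveD(3,4)[of X \<phi>] subfms_children(3,4)[of X \<phi> \<Psi>]
      trace_step.fixpoint[of m X \<phi> \<Psi>]
    unfolding main_formula_def by auto
next
  case (regeneration \<alpha> X \<beta> \<phi>)
  have sing: "L = {m}" "m = \<alpha>"
    using main_formula_active[OF m, of \<alpha>] regeneration by auto
  then have "d = Down" "L' = {\<phi>}"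
    using ch regeneration by (auto split: if_splits)
  then show ?thesis
    using sing regeneration trace_step.regeneration[of m X \<Psi> \<beta> \<phi>]
      binds_disjunctive[OF \<Psi> regeneration(5)] bindsD[OF regeneration(5)]
    unfolding main_formula_def by auto
next
  case modal
  have mc: "modal_children L d = Some L'" using ch modal by simp
  have "\<exists>as B. m = Arrow B \<and> premodal as B L"
  proof (cases "L = {m}")
    case True
    then obtain B where "m = Arrow B"
      using mc unfolding modal_children_def by (auto split: dir.splits if_splits)
    then show ?thesis using True premodal_single by blast
  qed (use m in \<open>auto simp: main_formula_def\<close>)
  then obtain as B where *: "m = Arrow B" "premodal as B L" by blast
  from modal_children_premodal[OF *(2) mc] obtain \<psi> where \<psi>: "d = Via B \<psi>" "\<psi> \<in> fset B" "L' = {\<psi>}" .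
  have "Arrow B \<in> L" "finite L" using *(2) unfolding premodal_def by auto
  then have "rank (Arrow B) \<le> sum rank L" by (intro member_le_sum) simp_all
  with rank_Arrow[OF \<psi>(2)] have less: "rank \<psi> < sum rank L" by linarith
  then show ?thesis
    using m * \<psi> modal less disjunctiveD(5)[of B \<psi>] subfms_children(5)[of B \<Psi> \<psi>]
      trace_step.modal_member[of \<Psi> B \<psi>] subfms_children(5)[of B "Arrow B" \<psi>]
    unfolding main_formula_def by auto
qed

section \<open>Branches and their parity\<close>

lemma branch_node_Suc [simp]: "branch_node \<delta> (Suc i) = branch_node \<delta> i @ [\<delta> i]"
  unfolding branch_node_def by simp

lemma length_branch_node [simp]: "length (branch_node \<delta> i) = i"
  unfolding branch_node_def by simp

lemma prefix_branch_node: "prefix u (branch_node \<delta> i) \<longleftrightarrow> (\<exists>j \<le> i. u = branch_node \<delta> j)"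
  by (induction i) (auto simp: branch_node_def[of _ 0] le_Suc_eq)

lemma strict_prefix_branch_node:
  "strict_prefix u (branch_node \<delta> i) \<longleftrightarrow> (\<exists>j < i. u = branch_node \<delta> j)"
  unfolding strict_prefix_def prefix_branch_node by (metis le_less length_branch_node nat_less_le)

lemma is_tableau_rule:
  "is_tableau T \<Longrightarrow> lab T v = Some L \<Longrightarrow>
    tableau_rule (goal T) L (active T v) (\<lambda>d. lab T (v @ [d]))"
  unfolding is_tableau_def by blast

lemma is_tableau_prefix:
  assumes "is_tableau T" "lab T v \<noteq> None" "prefix u v"
  shows "lab T u \<noteq> None"
proof -
  have "lab T (u @ ds) \<noteq> None \<Longrightarrow> lab T u \<noteq> None" for ds
  proof (induction ds rule: rev_induct)
    case (snoc d ds)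
    then show ?case using assms(1) unfolding is_tableau_def by (metis append_assoc)
  qed simp
  from this[of "drop (length u) v"] show ?thesis
    using assms(2,3) by (auto elim!: prefixE)
qed

definition regenerated_on :: "('p, 'v) tableau \<Rightarrow> (nat \<Rightarrow> ('p, 'v) dir) \<Rightarrow> 'v set" where
  "regenerated_on T \<delta> = {X. \<exists>\<^sub>\<infinity>i. active T (branch_node \<delta> i) = Some (Var X)}"

text \<open>The segment contains \<open>p\<close> but not \<open>q\<close>, so consecutive segments
  concatenate without overlap; \<open>modal_between\<close> uses the same convention.\<close>

definition regenerates_within ::
  "('p, 'v) tableau \<Rightarrow> 'v set \<Rightarrow> ('p, 'v) node \<Rightarrow> ('p, 'v) node \<Rightarrow> bool" where
  "regenerates_within T V p q \<longleftrightarrow> prefix p q \<and>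
     (\<forall>u X. prefix p u \<longrightarrow> strict_prefix u q \<longrightarrow> active T u = Some (Var X) \<longrightarrow> X \<in> V)"

definition modal_between :: "('p, 'v) tableau \<Rightarrow> ('p, 'v) node \<Rightarrow> ('p, 'v) node \<Rightarrow> bool" where
  "modal_between T p q \<longleftrightarrow> (\<exists>u. prefix p u \<and> strict_prefix u q \<and> modal_node T u)"

lemma regenerates_within_refl [simp]: "regenerates_within T V p p"
  unfolding regenerates_within_def by auto

lemma regenerates_within_prefix: "regenerates_within T V p q \<Longrightarrow> prefix p q"
  unfolding regenerates_within_def by auto

lemma regenerates_within_trans:
  assumes "regenerates_within T V p q" "regenerates_within T V q r"
  shows "regenerates_within T V p r"
  unfolding regenerates_within_def
proof (intro conjI allI impI)
  show "prefix p r"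
    using assms unfolding regenerates_within_def by (metis prefix_order.trans)
  fix u X assume u: "prefix p u" "strict_prefix u r" "active T u = Some (Var X)"
  have "strict_prefix u q \<or> prefix q u"
    using prefix_same_cases[of u r q] u(2) assms(2)
    unfolding regenerates_within_def strict_prefix_def by blast
  then show "X \<in> V" using assms u unfolding regenerates_within_def by blast
qed

lemma regenerates_within_mono:
  "regenerates_within T V p q \<Longrightarrow> V \<subseteq> W \<Longrightarrow> regenerates_within T W p q"
  unfolding regenerates_within_def by blast

lemma regenerates_within_step:
  "(\<And>X. active T p = Some (Var X) \<Longrightarrow> X \<in> V) \<Longrightarrow> regenerates_within T V p (p @ [d])"
  unfolding regenerates_within_def by (auto simp: strict_prefix_def dest: prefix_order.antisym)

lemma modal_between_mono:
  assumes "modal_between T p q" "prefix p' p" "prefix q q'"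
  shows "modal_between T p' q'"
proof -
  obtain u where u: "prefix p u" "strict_prefix u q" "modal_node T u"
    using assms(1) unfolding modal_between_def by blast
  have "prefix p' u" using assms(2) u(1) by (rule prefix_order.trans)
  moreover have "strict_prefix u q'" using u(2) assms(3) by (rule prefix_order.less_le_trans)
  ultimately show ?thesis using u(3) unfolding modal_between_def by blast
qed

section \<open>Reachability without regeneration\<close>

text \<open>
  \<open>leads g \<psi> \<chi>\<close>: a branch may run from a label \<open>{\<psi>}\<close> to a label \<open>{\<chi>}\<close> without any regeneration,
  passing a modal node if \<open>g\<close> holds.
\<close>

inductive leads :: "bool \<Rightarrow> ('p, 'v) fm \<Rightarrow> ('p, 'v) fm \<Rightarrow> bool" where
  "leads False \<psi> \<psi>"
| "leads g \<phi> \<chi> \<Longrightarrow> leads g (Or \<phi> \<psi>) \<chi>"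
| "leads g \<psi> \<chi> \<Longrightarrow> leads g (Or \<phi> \<psi>) \<chi>"
| "leads g \<phi> \<chi> \<Longrightarrow> leads g (Mu X \<phi>) \<chi>"
| "leads g \<phi> \<chi> \<Longrightarrow> leads g (Nu X \<phi>) \<chi>"
| "\<beta> \<in> fset B \<Longrightarrow> leads g \<beta> \<chi> \<Longrightarrow> leads True (Arrow B) \<chi>"
| "\<beta> \<in> fset B \<Longrightarrow> leads g \<beta> \<chi> \<Longrightarrow> set as \<subseteq> literals \<Longrightarrow> consistent (set as) \<Longrightarrow>
     leads True (And (conj_list as) (Arrow B)) \<chi>"

lemma no_dead_fixpoints_subfms:
  "no_dead_fixpoints \<Psi> \<Longrightarrow> \<phi> \<in> subfms \<Psi> \<Longrightarrow> no_dead_fixpoints \<phi>"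
  unfolding no_dead_fixpoints_def using subfms_mono by blast

lemma Arrow_member_subfms: "\<beta> \<in> fset B \<Longrightarrow> \<beta> \<in> subfms (Arrow B)"
  by (rule subfms_children(5)) simp_all

lemma no_dead_fixpoints_And:
  assumes "no_dead_fixpoints (And \<phi> \<psi>)" "disjunctive (And \<phi> \<psi>)"
  obtains as B where "\<phi> = conj_list as" "\<psi> = Arrow B" "set as \<subseteq> literals"
    "\<And>\<beta>. \<beta> \<in> fset B \<Longrightarrow> disjunctive \<beta>" "\<And>\<beta>. \<beta> \<in> fset B \<Longrightarrow> no_dead_fixpoints \<beta>"
    "consistent (set as) \<or> free_vars \<psi> = {} \<and> bound_vars \<psi> = {}"
proof -
  from disjunctiveD(1)[OF assms(2)] obtain as B
    where *: "set as \<subseteq> literals" "\<phi> = conj_list as" "\<psi> = Arrow B" "disjunctive \<psi>" by blast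
  have "consistent (set as) \<or> free_vars \<psi> = {} \<and> bound_vars \<psi> = {}"
    using assms(1) * unfolding no_dead_fixpoints_def by (metis subfms_refl)
  moreover have "no_dead_fixpoints \<beta>" if "\<beta> \<in> fset B" for \<beta>
    using no_dead_fixpoints_subfms[OF no_dead_fixpoints_subfms[OF assms(1), of \<psi>], of \<beta>]
      Arrow_member_subfms[OF that] *(3) by simp
  moreover have "disjunctive \<beta>" if "\<beta> \<in> fset B" for \<beta>
    using disjunctiveD(5) that * by blast
  ultimately show ?thesis using that * by blast
qed

lemma free_vars_conj_list: "set as \<subseteq> literals \<Longrightarrow> free_vars (conj_list as) = {}"
  by (induction as rule: conj_list.induct) (auto simp: literals_def)

lemma subfms_conj_list:
  "set as \<subseteq> literals \<Longrightarrow> Mu X \<phi> \<notin> subfms (conj_list as) \<and> Nu X \<phi> \<notin> subfms (conj_list as)"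
  by (induction as rule: conj_list.induct) (auto simp: literals_def)

text \<open>Follow the syntax tree down to an occurrence of \<open>X\<close>. Only an inconsistent
  conjunction of literals could block the way, and no variable occurs below one. If \<open>X\<close>
  is guarded in \<open>\<psi>\<close>, the way passes a modality.\<close>

lemma leads_free_var:
  assumes "X \<in> free_vars \<psi>" "disjunctive \<psi>" "no_dead_fixpoints \<psi>"
  shows "\<exists>g. leads g \<psi> (Var X) \<and> (X \<notin> unguarded_vars \<psi> \<longrightarrow> g)"
  using assms
proof (induction \<psi>)
  case (Var Y)
  then show ?case using leads.intros(1) by fastforce
next
  case (And \<phi> \<psi>)
  from no_dead_fixpoints_And[OF And.prems(3,2)] obtain as B
    where *: "\<phi> = conj_list as" "\<psi> = Arrow B" "set as \<subseteq> literals"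
    "consistent (set as) \<or> free_vars \<psi> = {} \<and> bound_vars \<psi> = {}" by metis
  have X: "X \<in> free_vars \<psi>" using And.prems(1) free_vars_conj_list[OF *(3)] *(1) by simp
  have "disjunctive \<psi>" using disjunctiveD(1)[OF And.prems(2)] by blast
  moreover have "no_dead_fixpoints \<psi>" using no_dead_fixpoints_subfms[OF And.prems(3)] by simp
  ultimately obtain g where "leads g \<psi> (Var X)" using And.IH(2) X by blast
  then obtain \<beta> g' where "\<beta> \<in> fset B" "leads g' \<beta> (Var X)"
    unfolding *(2) by (cases rule: leads.cases) auto
  \<comment> \<open>\<open>X\<close> is free in \<open>\<psi>\<close>, which rules out an
    inconsistent \<open>as\<close>.\<close>
  then have "leads True (And \<phi> \<psi>) (Var X)" using leads.intros(7) * X by blast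
  then show ?case by blast
next
  case (Or \<phi> \<psi>)
  then have "disjunctive \<phi>" "disjunctive \<psi>" "no_dead_fixpoints \<phi>" "no_dead_fixpoints \<psi>"
    using disjunctiveD(2)[OF Or.prems(2)] no_dead_fixpoints_subfms[OF Or.prems(3)] by auto
  then have "\<exists>g. leads g (Or \<phi> \<psi>) (Var X) \<and> (X \<notin> unguarded_vars \<phi> \<longrightarrow> g)
      \<or> leads g (Or \<phi> \<psi>) (Var X) \<and> (X \<notin> unguarded_vars \<psi> \<longrightarrow> g)"
    using Or.prems(1) Or.IH leads.intros(2,3) by (metis UnE free_vars.simps(7))
  then show ?case by auto
next
  case (Arrow B)
  then obtain \<beta> where \<beta>: "\<beta> \<in> fset B" "X \<in> free_vars \<beta>" by auto
  then have "disjunctive \<beta>" "no_dead_fixpoints \<beta>"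
    using disjunctiveD(5)[OF Arrow.prems(2)]
      no_dead_fixpoints_subfms[OF Arrow.prems(3) Arrow_member_subfms] \<beta>(1) by blast+
  then show ?case using Arrow.IH \<beta> leads.intros(6) by blast
next
  case (Mu Y \<psi>)
  then show ?case
    using disjunctiveD(3)[OF Mu.prems(2)] no_dead_fixpoints_subfms[OF Mu.prems(3), of \<psi>]
      leads.intros(4)[of _ \<psi> _ Y] by simp blast
next
  case (Nu Y \<psi>)
  then show ?case
    using disjunctiveD(4)[OF Nu.prems(2)] no_dead_fixpoints_subfms[OF Nu.prems(3), of \<psi>]
      leads.intros(5)[of _ \<psi> _ Y] by simp blast
qed auto

lemma leads_binder:
  assumes "binds \<psi> X \<beta> \<phi>" "disjunctive \<psi>" "no_dead_fixpoints \<psi>"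
  shows "\<exists>g. leads g \<psi> \<beta>"
  using assms
proof (induction \<psi>)
  case (And \<psi>1 \<psi>2)
  from no_dead_fixpoints_And[OF And.prems(3,2)] obtain as B
    where *: "\<psi>1 = conj_list as" "\<psi>2 = Arrow B" "set as \<subseteq> literals"
    "consistent (set as) \<or> free_vars \<psi>2 = {} \<and> bound_vars \<psi>2 = {}" by metis
  have \<beta>: "binds \<psi>2 X \<beta> \<phi>" using And.prems(1) subfms_conj_list[OF *(3)] *(1)
    unfolding binds_def by auto
  then have ne: "bound_vars \<psi>2 \<noteq> {}" using bindsD[OF \<beta>] by auto
  have "disjunctive \<psi>2" using disjunctiveD(1)[OF And.prems(2)] by blast
  moreover have "no_dead_fixpoints \<psi>2" using no_dead_fixpoints_subfms[OF And.prems(3)] by simp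
  ultimately obtain g where "leads g \<psi>2 \<beta>" using And.IH(2) \<beta> by blast
  then obtain \<beta>' g' where "\<beta>' \<in> fset B" "leads g' \<beta>' \<beta>"
    unfolding *(2) using \<beta> by (cases rule: leads.cases) (auto simp: binds_def)
  then have "leads True (And \<psi>1 \<psi>2) \<beta>" using leads.intros(7) * ne by blast
  then show ?case by blast
next
  case (Or \<psi>1 \<psi>2)
  then have "disjunctive \<psi>1" "disjunctive \<psi>2" "no_dead_fixpoints \<psi>1" "no_dead_fixpoints \<psi>2"
    using disjunctiveD(2)[OF Or.prems(2)] no_dead_fixpoints_subfms[OF Or.prems(3)] by auto
  moreover have "binds \<psi>1 X \<beta> \<phi> \<or> binds \<psi>2 X \<beta> \<phi>" using Or.prems(1) unfolding binds_def by auto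
  ultimately show ?case using Or.IH leads.intros(2,3) by blast
next
  case (Arrow B)
  then obtain \<gamma> where \<gamma>: "\<gamma> \<in> fset B" "binds \<gamma> X \<beta> \<phi>" unfolding binds_def by auto
  then have "disjunctive \<gamma>" "no_dead_fixpoints \<gamma>"
    using disjunctiveD(5)[OF Arrow.prems(2)]
      no_dead_fixpoints_subfms[OF Arrow.prems(3) Arrow_member_subfms] \<gamma>(1) by blast+
  then show ?case using Arrow.IH \<gamma> leads.intros(6) by blast
next
  case (Mu Y \<psi>)
  show ?case
  proof (cases "\<beta> = Mu Y \<psi>")
    case True
    then show ?thesis using leads.intros(1) by blast
  next
    case False
    then have "binds \<psi> X \<beta> \<phi>" using Mu.prems(1) unfolding binds_def by auto
    then show ?thesis
      using Mu.IH disjunctiveD(3)[OF Mu.prems(2)] no_dead_fixpoints_subfms[OF Mu.prems(3), of \<psi>]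
        leads.intros(4)[of _ \<psi> _ Y] by (metis insertCI subfms.simps(9) subfms_refl)
  qed
next
  case (Nu Y \<psi>)
  show ?case
  proof (cases "\<beta> = Nu Y \<psi>")
    case True
    then show ?thesis using leads.intros(1) by blast
  next
    case False
    then have "binds \<psi> X \<beta> \<phi>" using Nu.prems(1) unfolding binds_def by auto
    then show ?thesis
      using Nu.IH disjunctiveD(4)[OF Nu.prems(2)] no_dead_fixpoints_subfms[OF Nu.prems(3), of \<psi>]
        leads.intros(5)[of _ \<psi> _ Y] by (metis insertCI subfms.simps(10) subfms_refl)
  qed
qed (auto simp: binds_def)

text \<open>The tableau decides in which order conjunctions are decomposed, so the induction is on
  the sum of ranks rather than on the shape of the formula. When no conjunction is left, the modal
  rule is the only one, and consistency guarantees the child \<open>{\<beta>}\<close>.\<close>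

lemma premodal_reach:
  assumes T: "is_tableau T" and "premodal as B L" "consistent (set as)" "\<beta> \<in> fset B" "lab T p = Some L"
  shows "\<exists>q. lab T q = Some {\<beta>} \<and> regenerates_within T {} p q \<and> modal_between T p q"
  using assms(2-)
proof (induction "sum rank L" arbitrary: L p rule: less_induct)
  case less
  note mem = premodal_mem[OF less.prems(1)]
  show ?case using is_tableau_rule[OF T less.prems(4)]
  proof cases
    case (conj \<alpha> \<phi> \<psi>)
    have lab: "lab T (p @ [Down]) = Some (L - {And \<phi> \<psi>} \<union> {\<phi>, \<psi>})"
      using fun_cong[OF conj(2), of Down] conj(3) by simp
    have "sum rank (L - {And \<phi> \<psi>} \<union> {\<phi>, \<psi>}) < sum rank L"
      by (rule sum_replace_less) (use conj less.prems(1) in \<open>auto simp: premodal_def sum.insert_if\<close>)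
    from less.hyps[OF this premodal_step[OF less.prems(1)] less.prems(2,3) lab] conj
    obtain q where q: "lab T q = Some {\<beta>}" "regenerates_within T {} (p @ [Down]) q"
      "modal_between T (p @ [Down]) q" by auto
    have "regenerates_within T {} p (p @ [Down])"
      by (rule regenerates_within_step) (use conj in auto)
    from regenerates_within_trans[OF this q(2)] modal_between_mono[OF q(3)] q(1)
    show ?thesis by (meson prefixI prefix_order.refl)
  next
    case (disj \<alpha> \<phi> \<psi>)
    then show ?thesis using mem[of \<alpha>] by auto
  next
    case (fixpoint \<alpha> X \<phi>)
    then show ?thesis using mem[of \<alpha>] by auto
  next
    case (regeneration \<alpha> X \<beta> \<phi>)
    then show ?thesis using mem[of \<alpha>] by auto
  next
    case modal
    have "lab T (p @ [Via B \<beta>]) = Some {\<beta>}"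
      using fun_cong[OF modal(2), of "Via B \<beta>"]
        modal_children_consistent[OF less.prems(1) premodal_consistent[OF less.prems(1,2)] less.prems(3)]
      by simp
    moreover have "regenerates_within T {} p (p @ [Via B \<beta>])"
      by (rule regenerates_within_step) (use modal in auto)
    moreover have "modal_between T p (p @ [Via B \<beta>])"
      unfolding modal_between_def modal_node_def using modal(1) less.prems(4)
      by (intro exI[of _ p]) (auto simp: strict_prefix_def)
    ultimately show ?thesis by blast
  qed
qed

lemma singleton_rule:
  assumes "tableau_rule \<Psi> {\<psi>} a ch" "reducible \<Psi> \<psi>"
  shows "a = Some \<psi> \<and>
    ((\<exists>\<phi> \<chi>. \<psi> = And \<phi> \<chi> \<and> ch Down = Some {\<phi>, \<chi>}) \<or>
     (\<exists>\<phi> \<chi>. \<psi> = Or \<phi> \<chi> \<and> ch Lft = Some {\<phi>} \<and> ch Rgt = Some {\<chi>}) \<or>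
     (\<exists>X \<phi>. (\<psi> = Mu X \<phi> \<or> \<psi> = Nu X \<phi>) \<and> ch Down = Some {\<phi>}) \<or>
     (\<exists>X \<beta> \<phi>. \<psi> = Var X \<and> binds \<Psi> X \<beta> \<phi> \<and> ch Down = Some {\<phi>}))"
  using assms(1)
proof cases
  case modal
  then show ?thesis using assms(2) by blast
qed auto

lemma singleton_step:
  assumes T: "is_tableau T" and lab: "lab T p = Some {\<psi>}"
  shows "\<psi> = Or \<phi>1 \<phi>2 \<Longrightarrow> active T p = Some \<psi> \<and> lab T (p @ [Lft]) = Some {\<phi>1} \<and>
      lab T (p @ [Rgt]) = Some {\<phi>2}"
    and "\<psi> = Mu X \<phi>1 \<or> \<psi> = Nu X \<phi>1 \<Longrightarrow> active T p = Some \<psi> \<and> lab T (p @ [Down]) = Some {\<phi>1}"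
    and "\<psi> = Var X \<Longrightarrow> X \<in> bound_vars (goal T) \<Longrightarrow>
      active T p = Some \<psi> \<and> (\<exists>\<beta> \<phi>. binds (goal T) X \<beta> \<phi> \<and> lab T (p @ [Down]) = Some {\<phi>})"
    and "\<psi> = And \<phi>1 \<phi>2 \<Longrightarrow> active T p = Some \<psi> \<and> lab T (p @ [Down]) = Some {\<phi>1, \<phi>2}"
  using singleton_rule[OF is_tableau_rule[OF T lab]] by (auto simp: reducible_def)

text \<open>On a reducible singleton label the formula dictates the rule, so a way described by
  \<open>leads\<close> exists in every tableau. Labels that are not singletons arise only between a
  conjunction and the next modal node, where \<open>premodal_reach\<close> takes over.\<close>

lemma leads_reach:
  assumes T: "is_tableau T"
  shows "leads g \<psi> \<chi> \<Longrightarrow> lab T p = Some {\<psi>} \<Longrightarrow>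
    \<exists>q. lab T q = Some {\<chi>} \<and> regenerates_within T {} p q \<and> (g \<longrightarrow> modal_between T p q)"
proof (induction arbitrary: p rule: leads.induct)
  case (1 \<psi>)
  then show ?case by (intro exI[of _ p]) (auto simp: strict_prefix_def)
next
  case (2 g \<phi> \<chi> \<psi>)
  note s = singleton_step(1)[OF T 2(3) refl]
  from 2(2) s obtain q where q: "lab T q = Some {\<chi>}" "regenerates_within T {} (p @ [Lft]) q"
    "g \<longrightarrow> modal_between T (p @ [Lft]) q" by blast
  have "regenerates_within T {} p (p @ [Lft])" by (rule regenerates_within_step) (use s in auto)
  from regenerates_within_trans[OF this q(2)] modal_between_mono[of T "p @ [Lft]" q p q] q(1,3)
  show ?case by (meson prefixI prefix_order.refl)
next
  case (3 g \<psi> \<chi> \<phi>)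
  note s = singleton_step(1)[OF T 3(3) refl]
  from 3(2) s obtain q where q: "lab T q = Some {\<chi>}" "regenerates_within T {} (p @ [Rgt]) q"
    "g \<longrightarrow> modal_between T (p @ [Rgt]) q" by blast
  have "regenerates_within T {} p (p @ [Rgt])" by (rule regenerates_within_step) (use s in auto)
  from regenerates_within_trans[OF this q(2)] modal_between_mono[of T "p @ [Rgt]" q p q] q(1,3)
  show ?case by (meson prefixI prefix_order.refl)
next
  case (4 g \<phi> \<chi> X)
  note s = singleton_step(2)[OF T 4(3), of X \<phi>]
  from 4(2) s obtain q where q: "lab T q = Some {\<chi>}" "regenerates_within T {} (p @ [Down]) q"
    "g \<longrightarrow> modal_between T (p @ [Down]) q" by blast
  have "regenerates_within T {} p (p @ [Down])" by (rule regenerates_within_step) (use s in auto)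
  from regenerates_within_trans[OF this q(2)] modal_between_mono[of T "p @ [Down]" q p q] q(1,3)
  show ?case by (meson prefixI prefix_order.refl)
next
  case (5 g \<phi> \<chi> X)
  note s = singleton_step(2)[OF T 5(3), of X \<phi>]
  from 5(2) s obtain q where q: "lab T q = Some {\<chi>}" "regenerates_within T {} (p @ [Down]) q"
    "g \<longrightarrow> modal_between T (p @ [Down]) q" by blast
  have "regenerates_within T {} p (p @ [Down])" by (rule regenerates_within_step) (use s in auto)
  from regenerates_within_trans[OF this q(2)] modal_between_mono[of T "p @ [Down]" q p q] q(1,3)
  show ?case by (meson prefixI prefix_order.refl)
next
  case (6 \<beta> B g \<chi>)
  have "consistent (set [])" unfolding consistent_def by simp
  from premodal_reach[OF T premodal_single this 6(1,4)] obtain q where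
    q: "lab T q = Some {\<beta>}" "regenerates_within T {} p q" "modal_between T p q" by blast
  from 6(3)[OF q(1)] obtain r where r: "lab T r = Some {\<chi>}" "regenerates_within T {} q r" by blast
  from regenerates_within_trans[OF q(2) r(2)] modal_between_mono[OF q(3), of p r]
    regenerates_within_prefix[OF r(2)] r(1)
  show ?case by blast
next
  case (7 \<beta> B g \<chi> as)
  note s = singleton_step(4)[OF T 7(6) refl]
  from premodal_reach[OF T premodal_conj[OF 7(3)] 7(4,1)] s obtain q where
    q: "lab T q = Some {\<beta>}" "regenerates_within T {} (p @ [Down]) q" "modal_between T (p @ [Down]) q"
    by blast
  from 7(5)[OF q(1)] obtain r where r: "lab T r = Some {\<chi>}" "regenerates_within T {} q r" by blast
  have "regenerates_within T {} p (p @ [Down])" by (rule regenerates_within_step) (use s in auto)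
  from regenerates_within_trans[OF regenerates_within_trans[OF this q(2)] r(2)]
    modal_between_mono[OF q(3), of p r] regenerates_within_prefix[OF r(2)] r(1)
  show ?case by (meson prefixI)
qed

lemma binds_bound_vars: "binds \<Psi> X \<beta> \<phi> \<Longrightarrow> X \<in> bound_vars \<Psi>"
  unfolding bound_vars_binds by blast

lemma binds_obtain:
  assumes "X \<in> bound_vars \<Psi>"
  obtains \<beta> \<phi> where "binds \<Psi> X \<beta> \<phi>"
  using assms unfolding bound_vars_binds by blast

locale disjunctive_tableau =
  fixes T :: "('p, 'v) tableau" and \<Psi> :: "('p, 'v) fm"
  assumes wf: "well_formed \<Psi>" and disj: "disjunctive \<Psi>" and tab: "tableau_of T \<Psi>"
begin

lemma is_tab: "is_tableau T" and goal [simp]: "goal T = \<Psi>"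
  using tab unfolding tableau_of_def by auto

lemma named: "well_named \<Psi>"
  using wf unfolding well_formed_def by simp

lemma active_bound_var: "lab T u \<noteq> None \<Longrightarrow> active T u = Some (Var X) \<Longrightarrow> X \<in> bound_vars \<Psi>"
  using is_tableau_rule[OF is_tab, of u]
  by (auto elim!: tableau_rule.cases dest: binds_bound_vars)

end

locale disjunctive_branch = disjunctive_tableau +
  fixes \<delta> :: "nat \<Rightarrow> ('a, 'b) dir" and m :: "nat \<Rightarrow> ('a, 'b) fm"
  assumes main: "main_formula \<Psi> (m i) (the (lab T (branch_node \<delta> i)))"
    and trace_step: "trace_step \<Psi> (active T (branch_node \<delta> i)) (\<delta> i) (m i) (m (Suc i))"
    and regen: "active T (branch_node \<delta> i) = Some (Var X) \<Longrightarrow>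
      m i = Var X \<and> the (lab T (branch_node \<delta> i)) = {m i} \<and> (\<exists>\<beta>. binds \<Psi> X \<beta> (m (Suc i)))"
    and no_regen: "\<nexists>X. active T (branch_node \<delta> i) = Some (Var X) \<Longrightarrow>
      m (Suc i) \<in> subfms (m i) \<and>
      sum rank (the (lab T (branch_node \<delta> (Suc i)))) < sum rank (the (lab T (branch_node \<delta> i)))"

lemma (in disjunctive_tableau) disjunctive_branch_exists:
  assumes branch: "infinite_branch T \<delta>"
  shows "\<exists>m. disjunctive_branch T \<Psi> \<delta> m"
proof -
  define L where "L i = the (lab T (branch_node \<delta> i))" for i
  have lab: "lab T (branch_node \<delta> i) = Some (L i)" for i
    using branch unfolding infinite_branch_def L_def by simp
  define Q where "Q i x y \<longleftrightarrow> trace_step \<Psi> (active T (branch_node \<delta> i)) (\<delta> i) x y \<and>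
    (if \<exists>X. active T (branch_node \<delta> i) = Some (Var X)
     then \<exists>X \<beta>. active T (branch_node \<delta> i) = Some (Var X) \<and> x = Var X \<and> L i = {x} \<and> binds \<Psi> X \<beta> y
     else y \<in> subfms x \<and> sum rank (L (Suc i)) < sum rank (L i))" for i x y
  have "\<exists>m. \<forall>i. main_formula \<Psi> (m i) (L i) \<and> Q i (m i) (m (Suc i))"
  proof (rule dependent_nat_choice)
    have "L 0 = {\<Psi>}" using lab[of 0] is_tab unfolding is_tableau_def branch_node_def by simp
    then show "\<exists>x. main_formula \<Psi> x (L 0)" using disj unfolding main_formula_def by (intro exI[of _ \<Psi>]) auto
  next
    fix x i assume "main_formula \<Psi> x (L i)"
    moreover have "lab T (branch_node \<delta> i @ [\<delta> i]) = Some (L (Suc i))" using lab[of "Suc i"] by simp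
    ultimately show "\<exists>y. main_formula \<Psi> y (L (Suc i)) \<and> Q i x y"
      using main_formula_step[OF disj _ is_tableau_rule[OF is_tab lab[of i], unfolded goal]]
      unfolding Q_def by blast
  qed
  then obtain m where m: "\<And>i. main_formula \<Psi> (m i) (L i)" "\<And>i. Q i (m i) (m (Suc i))" by blast
  have "disjunctive_branch T \<Psi> \<delta> m"
  proof (unfold_locales)
    fix i X
    show "main_formula \<Psi> (m i) (the (lab T (branch_node \<delta> i)))" using m(1) L_def by metis
    show "trace_step \<Psi> (active T (branch_node \<delta> i)) (\<delta> i) (m i) (m (Suc i))"
      using m(2)[of i] unfolding Q_def by blast
    show "m i = Var X \<and> the (lab T (branch_node \<delta> i)) = {m i} \<and> (\<exists>\<beta>. binds \<Psi> X \<beta> (m (Suc i)))"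
      if "active T (branch_node \<delta> i) = Some (Var X)"
      using m(2)[of i] that unfolding Q_def L_def by auto
    show "m (Suc i) \<in> subfms (m i) \<and>
      sum rank (the (lab T (branch_node \<delta> (Suc i)))) < sum rank (the (lab T (branch_node \<delta> i)))"
      if "\<nexists>X. active T (branch_node \<delta> i) = Some (Var X)"
      using m(2)[of i] that unfolding Q_def L_def by (auto split: if_splits)
  qed
  then show ?thesis by (rule exI[of _ m])
qed

section \<open>Parity of a branch read off its regenerated variables\<close>

context disjunctive_branch
begin

lemma regenerated_bound_var: "active T (branch_node \<delta> i) = Some (Var X) \<Longrightarrow> X \<in> bound_vars \<Psi>"
  using regen[of i X] bound_vars_binds[of X \<Psi>] by blast

lemma regenerated_on_bound: "regenerated_on T \<delta> \<subseteq> bound_vars \<Psi>"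
  unfolding regenerated_on_def using regenerated_bound_var by (auto dest: frequently_ex)

lemma trace_main: "trace T \<delta> m"
  unfolding trace_def
proof (intro allI conjI)
  fix i
  show "m i \<in> the (lab T (branch_node \<delta> i))"
    using main[of i] unfolding main_formula_def premodal_def by auto
  show "trace_step (goal T) (active T (branch_node \<delta> i)) (\<delta> i) (m i) (m (Suc i))"
    using trace_step[of i] by simp
qed

text \<open>The label is a singleton whenever a variable is regenerated, so every trace passes
  through that variable.\<close>

lemma regenerated_inf_eq:
  assumes "trace T \<delta> \<tau>"
  shows "regenerated_inf T \<delta> \<tau> = regenerated_on T \<delta>"
proof -
  have "\<tau> i = Var X" if "active T (branch_node \<delta> i) = Some (Var X)" for i X
  proof -
    have "\<tau> i \<in> the (lab T (branch_node \<delta> i))" using assms unfolding trace_def by blast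
    then show ?thesis using regen[OF that] by auto
  qed
  then have "\<tau> i = Var X \<and> active T (branch_node \<delta> i) = Some (Var X) \<longleftrightarrow>
      active T (branch_node \<delta> i) = Some (Var X)" for i X
    by blast
  then show ?thesis unfolding regenerated_inf_def regenerated_on_def by simp
qed

lemma infinitely_many_regenerations: "\<exists>\<^sub>\<infinity>i. \<exists>X. active T (branch_node \<delta> i) = Some (Var X)"
proof (rule ccontr)
  assume "\<not> ?thesis"
  then obtain k where k: "\<And>i. i \<ge> k \<Longrightarrow> \<nexists>X. active T (branch_node \<delta> i) = Some (Var X)"
    unfolding not_frequently MOST_nat_le by blast
  define f where "f i = sum rank (the (lab T (branch_node \<delta> (k + i))))" for i
  have dec: "f (Suc i) < f i" for i
    using no_regen[OF k[of "k + i"]] unfolding f_def by simp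
  have "f i + i \<le> f 0" for i
  proof (induction i)
    case (Suc i)
    then show ?case using dec[of i] by simp
  qed simp
  from this[of "Suc (f 0)"] show False by simp
qed

text \<open>Pigeonhole over the finitely many bound variables.\<close>

lemma frequently_regenerated:
  assumes "\<exists>\<^sub>\<infinity>i. \<exists>X. active T (branch_node \<delta> i) = Some (Var X) \<and> P X"
  shows "\<exists>X \<in> regenerated_on T \<delta>. P X"
proof -
  have "\<exists>\<^sub>\<infinity>i. \<exists>X \<in> bound_vars \<Psi>. active T (branch_node \<delta> i) = Some (Var X) \<and> P X"
    using assms regenerated_bound_var by (elim frequently_elim1) blast
  then have "\<exists>X \<in> bound_vars \<Psi>. \<exists>\<^sub>\<infinity>i. active T (branch_node \<delta> i) = Some (Var X) \<and> P X"
    by (rule frequently_bex_finite[OF finite_bound_vars])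
  then show ?thesis
    unfolding regenerated_on_def by (metis (mono_tags, lifting) frequently_elim1 frequently_ex mem_Collect_eq)
qed

lemma eventually_regenerated:
  "\<forall>\<^sub>\<infinity>i. \<forall>X. active T (branch_node \<delta> i) = Some (Var X) \<longrightarrow> X \<in> regenerated_on T \<delta>"
proof (rule ccontr)
  assume "\<not> ?thesis"
  then have "\<exists>\<^sub>\<infinity>i. \<exists>X. active T (branch_node \<delta> i) = Some (Var X) \<and> X \<notin> regenerated_on T \<delta>"
    unfolding not_eventually by (elim frequently_elim1) blast
  from frequently_regenerated[OF this] show False by blast
qed

text \<open>All traces regenerate the same variables infinitely often, so they agree on the
  outermost one. It is unique because two binders that are subformulas of each other are equal, by
  rank.\<close>

lemma odd_branch_iff:
  assumes X: "X \<in> regenerated_on T \<delta>" "binds \<Psi> X \<gamma> \<chi>"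
    and outer: "\<And>Y \<beta> \<psi>. Y \<in> regenerated_on T \<delta> \<Longrightarrow> binds \<Psi> Y \<beta> \<psi> \<Longrightarrow> \<beta> \<in> subfms \<gamma>"
  shows "odd_branch T \<delta> \<longleftrightarrow> X \<in> mu_bound \<Psi>"
proof
  assume "X \<in> mu_bound \<Psi>"
  then obtain \<phi> where \<phi>: "Mu X \<phi> \<in> subfms \<Psi>" unfolding mu_bound_def by blast
  then have "\<gamma> = Mu X \<phi>"
    using well_named_unique[OF named X(2), of "Mu X \<phi>" \<phi>] unfolding binds_def by simp
  then have "mu_trace T \<delta> m"
    unfolding mu_trace_def regenerated_inf_eq[OF trace_main] goal
    using trace_main X(1) \<phi> outer by blast
  then show "odd_branch T \<delta>" unfolding odd_branch_def by blast
next
  assume "odd_branch T \<delta>"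
  then obtain \<tau> Z \<phi> where \<tau>: "trace T \<delta> \<tau>" and Z: "Z \<in> regenerated_on T \<delta>" "Mu Z \<phi> \<in> subfms \<Psi>"
    and max: "\<And>Y \<beta> \<psi>. Y \<in> regenerated_on T \<delta> \<Longrightarrow> binds \<Psi> Y \<beta> \<psi> \<Longrightarrow> \<beta> \<in> subfms (Mu Z \<phi>)"
    unfolding odd_branch_def mu_trace_def goal by (metis regenerated_inf_eq)
  have Zb: "binds \<Psi> Z (Mu Z \<phi>) \<phi>" using Z(2) unfolding binds_def by simp
  have "\<gamma> = Mu Z \<phi>"
    using subfms_rank[OF max[OF X]] subfms_rank[OF outer[OF Z(1) Zb]] by auto
  then show "X \<in> mu_bound \<Psi>"
    using X(2) unfolding binds_def mu_bound_def by auto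
qed

text \<open>
  The outermost among the variables regenerated infinitely often has maximal priority. It is found
  as a variable of maximal binder among those of maximal priority: once it is regenerated, the main
  formula can no longer leave its binder.
\<close>

lemma odd_branch_priority:
  assumes \<Omega>: "priority_assignment \<Psi> n \<Omega>"
  obtains X where "X \<in> regenerated_on T \<delta>" "\<And>Y. Y \<in> regenerated_on T \<delta> \<Longrightarrow> \<Omega> Y \<le> \<Omega> X"
    "odd_branch T \<delta> \<longleftrightarrow> odd (\<Omega> X)"
proof -
  define R where "R = regenerated_on T \<delta>"
  have R_bound: "R \<subseteq> bound_vars \<Psi>" unfolding R_def by (rule regenerated_on_bound)
  then have fin: "finite R" using finite_bound_vars finite_subset by blast
  have "R \<noteq> {}"
    using frequently_regenerated[of "\<lambda>_. True"] infinitely_many_regenerations unfolding R_def by auto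
  then have top: "Max (\<Omega> ` R) \<in> \<Omega> ` R" using fin by (intro Max_in) auto
  define M where "M = {X \<in> R. \<Omega> X = Max (\<Omega> ` R)}"
  have "M \<noteq> {}" "finite M" using top fin unfolding M_def by auto
  then have "Max (binder_rank \<Psi> ` M) \<in> binder_rank \<Psi> ` M" by (intro Max_in) auto
  then obtain X where X: "X \<in> M" and "binder_rank \<Psi> X = Max (binder_rank \<Psi> ` M)" by auto
  then have X_max: "binder_rank \<Psi> Y \<le> binder_rank \<Psi> X" if "Y \<in> M" for Y
    using that \<open>finite M\<close> by simp
  have XR: "X \<in> R" using X unfolding M_def by simp
  have \<Omega>_max: "\<Omega> Y \<le> \<Omega> X" if "Y \<in> R" for Y
    using X Max_ge[of "\<Omega> ` R" "\<Omega> Y"] that fin unfolding M_def by simp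
  obtain \<gamma> \<chi> where \<gamma>: "binds \<Psi> X \<gamma> \<chi>" using binds_obtain[OF subsetD[OF R_bound XR]] .
  obtain k where k: "\<And>i Y. i \<ge> k \<Longrightarrow> active T (branch_node \<delta> i) = Some (Var Y) \<Longrightarrow> Y \<in> R"
    using eventually_regenerated unfolding MOST_nat_le R_def by blast
  obtain k' where k': "k' \<ge> k" "active T (branch_node \<delta> k') = Some (Var X)"
    using XR unfolding R_def regenerated_on_def INFM_nat_le by blast
  have bound_inside: "Y \<in> bound_vars \<gamma>" if "Y \<in> R" "Var Y \<in> subfms \<gamma>" for Y
  proof (rule ccontr)
    assume "Y \<notin> bound_vars \<gamma>"
    \<comment> \<open>Such a \<open>Y\<close> would have at least the priority of \<open>X\<close>,
      hence the maximal one, and a larger binder rank, against the choice of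
      \<open>X\<close>.\<close>
    then have "depends \<Psi> X Y"
      using Var_subfms[OF that(2)] \<gamma> that(1) R_bound unfolding depends_def by blast
    then have "Y \<in> M" "binder_rank \<Psi> X < binder_rank \<Psi> Y"
      using priority_assignment_depends[OF \<Omega>] \<Omega>_max[OF that(1)] X that(1)
        depends_binder_rank[OF named] unfolding M_def by force+
    then show False using X_max by force
  qed
  have binder_inside: "\<beta> \<in> subfms \<gamma>" if "Y \<in> R" "Var Y \<in> subfms \<gamma>" "binds \<Psi> Y \<beta> \<psi>" for Y \<beta> \<psi>
  proof -
    have "Y \<in> bound_vars \<gamma>" using bound_inside that(1,2) .
    then obtain \<beta>' \<psi>' where "binds \<gamma> Y \<beta>' \<psi>'" by (rule binds_obtain)
    then show ?thesis
      using binds_subfms[of \<gamma> Y \<beta>' \<psi>' \<Psi>] bindsD[OF \<gamma>] bindsD[of \<gamma> Y \<beta>' \<psi>']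
        well_named_unique[OF named that(3)] by blast
  qed
  \<comment> \<open>Right after the regeneration at \<open>k'\<close> the main formula is the body
    of \<open>\<gamma>\<close>. From there it moves to subformulas or to bodies of binders inside
    \<open>\<gamma>\<close>.\<close>
  have inside: "m (Suc (k' + j)) \<in> subfms \<gamma>" for j
  proof (induction j)
    case 0
    show ?case using regen[OF k'(2)] well_named_unique[OF named \<gamma>] bindsD[OF \<gamma>] by auto
  next
    case (Suc j)
    let ?i = "Suc (k' + j)"
    show ?case
    proof (cases "\<exists>Y. active T (branch_node \<delta> ?i) = Some (Var Y)")
      case True
      then obtain Y where Y: "active T (branch_node \<delta> ?i) = Some (Var Y)" by blast
      from regen[OF Y] obtain \<beta> where \<beta>: "m ?i = Var Y" "binds \<Psi> Y \<beta> (m (Suc ?i))" by blast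
      have "\<beta> \<in> subfms \<gamma>"
        using binder_inside[OF _ _ \<beta>(2)] k[OF _ Y] k'(1) Suc \<beta>(1) by simp
      then have "m (Suc ?i) \<in> subfms \<gamma>" using bindsD[OF \<beta>(2)] subfms_mono by blast
      then show ?thesis by simp
    next
      case False
      then have "m (Suc ?i) \<in> subfms \<gamma>" using no_regen Suc subfms_mono by blast
      then show ?thesis by simp
    qed
  qed
  have outer: "\<beta> \<in> subfms \<gamma>" if "Y \<in> R" "binds \<Psi> Y \<beta> \<psi>" for Y \<beta> \<psi>
  proof -
    have "\<exists>i \<ge> Suc k'. active T (branch_node \<delta> i) = Some (Var Y)"
      using that(1) unfolding R_def regenerated_on_def INFM_nat_le by blast
    then obtain i where i: "i \<ge> Suc k'" "active T (branch_node \<delta> i) = Some (Var Y)" by blast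
    then obtain j where "i = Suc (k' + j)" by (metis add_Suc le_iff_add)
    then have "Var Y \<in> subfms \<gamma>" using inside[of j] regen[OF i(2)] by simp
    then show ?thesis using binder_inside that by blast
  qed
  have "odd_branch T \<delta> \<longleftrightarrow> X \<in> mu_bound \<Psi>"
    using odd_branch_iff[OF _ \<gamma>] XR outer unfolding R_def by blast
  also have "\<dots> \<longleftrightarrow> odd (\<Omega> X)"
    using \<Omega> XR R_bound unfolding priority_assignment_def bound_vars_def by blast
  finally show ?thesis using that[of X] XR \<Omega>_max unfolding R_def by blast
qed

end

section \<open>Core nodes along a branch\<close>

definition core_nodes_above :: "('p, 'v) tableau \<Rightarrow> ('p, 'v) node \<Rightarrow> ('p, 'v) node list" where
  "core_nodes_above T p = filter (core_node T) (map (\<lambda>i. take i p) [0..<length p])"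

lemma core_nodes_above_Nil [simp]: "core_nodes_above T [] = []"
  unfolding core_nodes_above_def by simp

lemma core_nodes_above_snoc:
  "core_nodes_above T (p @ [d]) = core_nodes_above T p @ (if core_node T p then [p] else [])"
proof -
  have "map (\<lambda>i. take i (p @ [d])) [0..<length p] = map (\<lambda>i. take i p) [0..<length p]"
    by (rule map_cong) auto
  moreover have "core_nodes_above T (p @ [d]) =
      filter (core_node T) (map (\<lambda>i. take i (p @ [d])) ([0..<length p] @ [length p]))"
    unfolding core_nodes_above_def by simp
  ultimately show ?thesis unfolding core_nodes_above_def by (simp only: map_append filter_append) simp
qed

lemma strict_prefix_snoc: "strict_prefix u (p @ [d]) \<longleftrightarrow> prefix u p"
  unfolding strict_prefix_def by (auto dest: prefix_length_le)

lemma set_core_nodes_above: "set (core_nodes_above T p) = {u. strict_prefix u p \<and> core_node T u}"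
proof (induction p rule: rev_induct)
  case (snoc d p)
  then show ?case by (auto simp: core_nodes_above_snoc strict_prefix_snoc prefix_order.le_less)
qed simp

lemma core_nodes_above_last:
  assumes "core_nodes_above T p \<noteq> []"
  shows "core_node T (last (core_nodes_above T p))" "strict_prefix (last (core_nodes_above T p)) p"
    "\<And>w. strict_prefix (last (core_nodes_above T p)) w \<Longrightarrow> strict_prefix w p \<Longrightarrow> \<not> core_node T w"
proof -
  have "last (core_nodes_above T p) \<in> set (core_nodes_above T p)" using assms by simp
  then show "core_node T (last (core_nodes_above T p))" "strict_prefix (last (core_nodes_above T p)) p"
    unfolding set_core_nodes_above by auto
  show "strict_prefix (last (core_nodes_above T p)) w \<Longrightarrow> strict_prefix w p \<Longrightarrow> \<not> core_node T w" for w
    using assms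
  proof (induction p rule: rev_induct)
    case (snoc d p)
    from snoc.prems(2) have w: "prefix w p" by (auto simp: strict_prefix_def)
    show ?case
    proof (cases "core_node T p")
      case True
      then have "strict_prefix p w" using snoc.prems(1) by (simp add: core_nodes_above_snoc)
      then show ?thesis using w by (meson prefix_order.leD)
    next
      case False
      then show ?thesis using snoc w by (auto simp: core_nodes_above_snoc strict_prefix_def)
    qed
  qed simp
qed

lemma core_node_lab: "core_node T v \<Longrightarrow> lab T v \<noteq> None"
  unfolding core_node_def modal_node_def disj_node_def by auto

text \<open>A topmost disjunction above \<open>r\<close> would itself be a core node.\<close>

lemma core_root_no_disj:
  assumes "core_root T r"
  shows "strict_prefix u r \<Longrightarrow> \<not> disj_node T u"
proof (induction "length u" arbitrary: u rule: less_induct)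
  case less
  have "\<not> core_node T u" using assms less.prems unfolding core_root_def by blast
  moreover have "\<not> disj_node T w" if "strict_prefix w u" for w
    using less.hyps[OF prefix_length_less[OF that]] that less.prems
    by (meson prefix_order.less_trans)
  ultimately show ?case unfolding core_node_def by blast
qed

lemma core_root_Down:
  assumes T: "is_tableau T" and r: "core_root T r"
  shows "prefix u r \<Longrightarrow> u = replicate (length u) Down"
proof (induction u rule: rev_induct)
  case (snoc d u)
  have u: "strict_prefix u r" using snoc.prems by (rule prefix_snocD)
  have lab: "lab T u \<noteq> None" "lab T (u @ [d]) \<noteq> None"
    using is_tableau_prefix[OF T core_node_lab] r snoc.prems u
    unfolding core_root_def strict_prefix_def by blast+
  have *: "\<not> disj_node T u" "\<not> modal_node T u"
    using core_root_no_disj[OF r u] r u unfolding core_root_def core_node_def by auto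
  obtain L where L: "lab T u = Some L" using lab(1) by blast
  have "d = Down" using is_tableau_rule[OF T L]
  proof cases
    case (conj \<alpha> \<phi> \<psi>)
    then show ?thesis using fun_cong[OF conj(2), of d] lab(2) by (auto split: if_splits)
  next
    case (disj \<alpha> \<phi> \<psi>)
    then show ?thesis using * lab(1) unfolding disj_node_def by blast
  next
    case (fixpoint \<alpha> X \<phi>)
    then show ?thesis using fun_cong[OF fixpoint(2), of d] lab(2) by (auto split: if_splits)
  next
    case (regeneration \<alpha> X \<beta> \<phi>)
    then show ?thesis using fun_cong[OF regeneration(2), of d] lab(2) by (auto split: if_splits)
  next
    case modal
    then show ?thesis using * lab(1) unfolding modal_node_def by blast
  qed
  moreover have "u = replicate (length u) Down"
    using snoc.IH u unfolding strict_prefix_def by blast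
  ultimately show ?case by (metis length_append_singleton replicate_Suc replicate_append_same)
qed simp

text \<open>No branching rule is applied above a core root, so all core roots lie on one stem of
  \<open>Down\<close> steps. Uniqueness lets the two bisimulations start at the same node of the
  middle tableau.\<close>

lemma core_root_unique:
  assumes T: "is_tableau T" and r: "core_root T r" "core_root T r'"
  shows "r = r'"
proof -
  have *: "r = replicate (length r) Down" "r' = replicate (length r') Down"
    using core_root_Down[OF T r(1), of r] core_root_Down[OF T r(2), of r'] by simp_all
  have "prefix (replicate a Down) (replicate b Down)" if "a \<le> b" for a b
    using that by (metis le_add_diff_inverse prefixI replicate_add)
  then have "prefix r r' \<or> prefix r' r" using * by (metis linear)
  then show ?thesis using r unfolding core_root_def strict_prefix_def by blast
qed

section \<open>Infinite core paths and their branches\<close>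

lemma list_limit:
  assumes "\<And>n. strict_prefix (H n) (H (Suc n))"
  shows "\<exists>h. \<forall>n. H n = map h [0..<length (H n)]"
proof -
  have mono: "prefix (H n) (H n')" if "n \<le> n'" for n n'
    using that
  proof (induction rule: dec_induct)
    case (step j)
    then show ?case using assms[of j] unfolding strict_prefix_def by (meson prefix_order.trans)
  qed simp
  have len: "n \<le> length (H n)" for n
  proof (induction n)
    case (Suc n)
    then show ?case using prefix_length_less[OF assms[of n]] by simp
  qed simp
  \<comment> \<open>\<open>H (Suc i)\<close> is long enough to have an entry at position
    \<open>i\<close>, and comparable lists agree where both are defined.\<close>
  have "H n ! i = H (Suc i) ! i" if "i < length (H n)" for n i
  proof -
    have "i < length (H (Suc i))" using len[of "Suc i"] by simp
    then show ?thesis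
      using mono[of n "Suc i"] mono[of "Suc i" n] that by (metis linear nth_append prefixE)
  qed
  then have "H n = map (\<lambda>i. H (Suc i) ! i) [0..<length (H n)]" for n
    by (intro nth_equalityI) auto
  then show ?thesis by blast
qed

lemma core_path_length:
  assumes "core_path T \<pi>"
  shows "i \<le> length (\<pi> i)"
proof (induction i)
  case (Suc i)
  have "strict_prefix (\<pi> i) (\<pi> (Suc i))" using assms unfolding core_path_def core_succ_def by blast
  from prefix_length_less[OF this] Suc show ?case by simp
qed simp

lemma core_path_lab: "core_path T \<pi> \<Longrightarrow> lab T (\<pi> i) \<noteq> None"
  using core_node_lab unfolding core_path_def core_succ_def by blast

text \<open>The nodes of a core path grow without bound and so lie on one branch only; the
  existential quantifier in \<open>odd_core_path\<close> leaves no choice.\<close>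

lemma odd_core_path_iff:
  assumes \<pi>: "core_path T \<pi>" and \<delta>: "infinite_branch T \<delta>" "range \<pi> \<subseteq> range (branch_node \<delta>)"
  shows "odd_core_path T \<pi> \<longleftrightarrow> odd_branch T \<delta>"
proof -
  have on: "\<pi> i = branch_node \<epsilon> (length (\<pi> i))" if "range \<pi> \<subseteq> range (branch_node \<epsilon>)" for i \<epsilon>
    using that by (metis imageE length_branch_node range_subsetD)
  have "\<epsilon> = \<delta>" if \<epsilon>: "range \<pi> \<subseteq> range (branch_node \<epsilon>)" for \<epsilon>
  proof
    fix i
    have "i < length (\<pi> (Suc i))" using core_path_length[OF \<pi>, of "Suc i"] by simp
    then have "branch_node \<eta> (length (\<pi> (Suc i))) ! i = \<eta> i"
      for \<eta> :: "nat \<Rightarrow> ('a, 'b) dir"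
      unfolding branch_node_def by simp
    then show "\<epsilon> i = \<delta> i" using on[OF \<epsilon>, of "Suc i"] on[OF \<delta>(2), of "Suc i"] by metis
  qed
  then show ?thesis unfolding odd_core_path_def using \<delta> by blast
qed

lemma core_path_branch:
  assumes T: "is_tableau T" and \<pi>: "core_path T \<pi>"
  obtains \<delta> where "infinite_branch T \<delta>" "\<And>i. \<pi> i = branch_node \<delta> (length (\<pi> i))"
proof -
  have "strict_prefix (\<pi> i) (\<pi> (Suc i))" for i using \<pi> unfolding core_path_def core_succ_def by blast
  from list_limit[of \<pi>, OF this] obtain \<delta> where \<delta>: "\<And>i. \<pi> i = branch_node \<delta> (length (\<pi> i))"
    unfolding branch_node_def by blast
  have "lab T (branch_node \<delta> i) \<noteq> None" for i
  proof -
    have "prefix (branch_node \<delta> i) (\<pi> i)"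
      using \<delta>[of i] core_path_length[OF \<pi>, of i] prefix_branch_node by metis
    with is_tableau_prefix[OF T core_path_lab[OF \<pi>]] show ?thesis by blast
  qed
  then show ?thesis using that[of \<delta>] \<delta> unfolding infinite_branch_def by blast
qed

section \<open>Loops in the tableau\<close>

locale live_tableau = disjunctive_tableau +
  assumes live: "no_dead_fixpoints \<Psi>"
begin

lemma live_subfms: "\<psi> \<in> subfms \<Psi> \<Longrightarrow> no_dead_fixpoints \<psi>"
  using no_dead_fixpoints_subfms[OF live] .

lemma reach_binder_body:
  assumes "lab T p = Some {\<psi>}" "\<psi> \<in> subfms \<Psi>" "disjunctive \<psi>" "binds \<psi> Z \<beta> \<phi>"
  shows "\<exists>q. lab T q = Some {\<phi>} \<and> regenerates_within T {} p q"
proof -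
  obtain g where "leads g \<psi> \<beta>" using leads_binder[OF assms(4,3) live_subfms[OF assms(2)]] by blast
  from leads_reach[OF is_tab this assms(1)] obtain q where
    q: "lab T q = Some {\<beta>}" "regenerates_within T {} p q" by blast
  have \<beta>: "\<beta> = Mu Z \<phi> \<or> \<beta> = Nu Z \<phi>" using assms(4) unfolding binds_def by blast
  note s = singleton_step(2)[OF is_tab q(1) \<beta>]
  have "regenerates_within T {} q (q @ [Down])"
    by (rule regenerates_within_step) (use s \<beta> in auto)
  from regenerates_within_trans[OF q(2) this] s show ?thesis by blast
qed

lemma reach_regeneration:
  assumes "lab T p = Some {\<psi>}" "\<psi> \<in> subfms \<Psi>" "disjunctive \<psi>" "X \<in> free_vars \<psi>" "binds \<Psi> X \<beta> \<phi>"
  shows "\<exists>q. lab T q = Some {\<phi>} \<and> regenerates_within T {X} p q \<and>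
    (\<exists>u. prefix p u \<and> strict_prefix u q \<and> active T u = Some (Var X)) \<and>
    (X \<notin> unguarded_vars \<psi> \<longrightarrow> modal_between T p q)"
proof -
  obtain g where g: "leads g \<psi> (Var X)" "X \<notin> unguarded_vars \<psi> \<longrightarrow> g"
    using leads_free_var[OF assms(4,3) live_subfms[OF assms(2)]] by blast
  from leads_reach[OF is_tab g(1) assms(1)] obtain q where
    q: "lab T q = Some {Var X}" "regenerates_within T {} p q" "g \<longrightarrow> modal_between T p q" by blast
  obtain \<beta>' \<phi>' where s: "active T q = Some (Var X)" "binds \<Psi> X \<beta>' \<phi>'" "lab T (q @ [Down]) = Some {\<phi>'}"
    using singleton_step(3)[OF is_tab q(1) refl] binds_bound_vars[OF assms(5)] by auto
  have "lab T (q @ [Down]) = Some {\<phi>}" using s well_named_unique[OF named s(2) assms(5)] by simp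
  moreover have "regenerates_within T {X} q (q @ [Down])"
    by (rule regenerates_within_step) (use s in auto)
  with regenerates_within_mono[OF q(2), of "{X}"] have "regenerates_within T {X} p (q @ [Down])"
    using regenerates_within_trans by blast
  moreover have "prefix p q \<and> strict_prefix q (q @ [Down]) \<and> active T q = Some (Var X)"
    using s regenerates_within_prefix[OF q(2)] by (simp add: strict_prefix_def)
  moreover have "X \<notin> unguarded_vars \<psi> \<longrightarrow> modal_between T p (q @ [Down])"
    using modal_between_mono[of T p q p "q @ [Down]"] q(3) g(2) by simp
  ultimately show ?thesis by blast
qed

lemma body_loop:
  assumes "lab T p = Some {\<phi>}" "binds \<Psi> X \<beta> \<phi>"
  shows "\<exists>q. lab T q = Some {\<phi>} \<and> regenerates_within T {X} p q \<and>
    (\<exists>u. prefix p u \<and> strict_prefix u q \<and> active T u = Some (Var X)) \<and> modal_between T p q"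
proof -
  have "X \<in> free_vars \<phi>" "X \<notin> unguarded_vars \<phi>"
    using wf assms(2) unfolding well_formed_def guarded_def by blast+
  then show ?thesis
    using reach_regeneration[OF assms(1) _ _ _ assms(2)] bindsD[OF assms(2)]
      binds_disjunctive[OF disj assms(2)] by blast
qed

end

section \<open>Linked plays on two equivalent tableaus\<close>

type_synonym ('p, 'v) node_triple = "('p, 'v) node \<times> ('p, 'v) node \<times> ('p, 'v) node"

text \<open>The two sides have different roles: loops are built in \<open>T1\<close>, while
  priorities are read off in \<open>T2\<close> under an arbitrary assignment \<open>\<Omega>\<close>
  of \<open>\<phi>2\<close>.\<close>

locale linked_tableaus =
  L: live_tableau T1 \<phi>1 + R: disjunctive_tableau T2 \<phi>2
  for T1 T2 :: "('p, 'v) tableau" and \<phi>1 \<phi>2 +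
  fixes T :: "('p, 'v) tableau" and Z1 Z2 and n :: nat and \<Omega> :: "'v \<Rightarrow> nat"
  assumes T: "is_tableau T"
    and Z1: "core_bisimulation T1 T Z1" and Z2: "core_bisimulation T2 T Z2"
    and \<Omega>: "priority_assignment \<phi>2 n \<Omega>"
begin

text \<open>
  A play is a list of triples of nodes of the cores of \<open>T1\<close>, \<open>T\<close> and \<open>T2\<close>. Only stepwise linked
  paths are compared: the composition of the two bisimulations need not preserve parities, since
  nodes related through \<open>T\<close> need not be related through the nodes of a single path of \<open>T\<close>.
\<close>

definition linked ::
  "('p, 'v) node_triple list \<Rightarrow> ('p, 'v) node_triple \<Rightarrow> bool" where
  "linked hs x \<longleftrightarrow> Z1 (fst x) (fst (snd x)) \<and> Z2 (snd (snd x)) (fst (snd x)) \<and>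
     (if hs = [] then core_root T1 (fst x) \<and> core_root T (fst (snd x)) \<and> core_root T2 (snd (snd x))
      else core_succ T1 (fst (last hs)) (fst x) \<and>
        core_succ T (fst (snd (last hs))) (fst (snd x)) \<and>
        core_succ T2 (snd (snd (last hs))) (snd (snd x)))"

definition play :: "('p, 'v) node_triple list \<Rightarrow> bool" where
  "play hs \<longleftrightarrow> (\<forall>i < length hs. linked (take i hs) (hs ! i))"

lemma play_snoc: "play (hs @ [x]) \<longleftrightarrow> play hs \<and> linked hs x"
  unfolding play_def by (auto simp: less_Suc_eq nth_append)

lemma play_prefix: "play (hs @ ks) \<Longrightarrow> play hs"
proof (induction ks rule: rev_induct)
  case (snoc k ks)
  then show ?case using play_snoc[of "hs @ ks" k] by simp
qed simp

lemma linked_root: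
  assumes "core_root T1 r"
  shows "\<exists>x. linked [] x \<and> fst x = r"
proof -
  obtain r1 t1 where 1: "core_root T1 r1" "core_root T t1" "Z1 r1 t1"
    using Z1 unfolding core_bisimulation_def by blast
  obtain r2 t2 where 2: "core_root T2 r2" "core_root T t2" "Z2 r2 t2"
    using Z2 unfolding core_bisimulation_def by blast
  have "r1 = r" "t1 = t2"
    using core_root_unique[OF L.is_tab 1(1) assms] core_root_unique[OF T 1(2) 2(2)] by auto
  then show ?thesis using 1 2 by (intro exI[of _ "(r, t2, r2)"]) (simp add: linked_def)
qed

text \<open>The forward clause of \<open>Z1\<close> carries the move from \<open>T1\<close> to
  \<open>T\<close>, and the backward clause of \<open>Z2\<close> carries it on to
  \<open>T2\<close>.\<close>

lemma linked_succ:
  assumes "play hs" "hs \<noteq> []" "core_succ T1 (fst (last hs)) a"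
  shows "\<exists>x. linked hs x \<and> fst x = a"
proof -
  have "linked (butlast hs) (last hs)" using play_snoc[of "butlast hs" "last hs"] assms by simp
  then have *: "Z1 (fst (last hs)) (fst (snd (last hs)))" "Z2 (snd (snd (last hs))) (fst (snd (last hs)))"
    unfolding linked_def by auto
  obtain b where b: "core_succ T (fst (snd (last hs))) b" "Z1 a b"
    using Z1 *(1) assms(3) unfolding core_bisimulation_def by meson
  obtain c where c: "core_succ T2 (snd (snd (last hs))) c" "Z2 c b"
    using Z2 *(2) b(1) unfolding core_bisimulation_def by meson
  show ?thesis using assms b c by (intro exI[of _ "(a, b, c)"]) (simp add: linked_def)
qed

text \<open>The play \<open>hs\<close> has followed the branch of \<open>T1\<close> up to but excluding the node \<open>p\<close>.\<close>

definition follows where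
  "follows p hs \<longleftrightarrow> lab T1 p \<noteq> None \<and> play hs \<and> map fst hs = core_nodes_above T1 p"

lemma follows_Nil: "follows [] []"
  using L.is_tab unfolding follows_def play_def is_tableau_def by simp

text \<open>Every core node passed on the left is matched by one new triple. Earlier triples are
  never revised, so growing plays have a limit.\<close>

lemma follows_extend:
  assumes "follows p hs" "prefix p q" "lab T1 q \<noteq> None"
  shows "\<exists>ks. follows q (hs @ ks)"
proof -
  have "lab T1 (p @ ds) \<noteq> None \<Longrightarrow> \<exists>ks. follows (p @ ds) (hs @ ks)" for ds
  proof (induction ds rule: rev_induct)
    case Nil
    show ?case by (rule exI[of _ "[]"]) (use assms(1) in simp)
  next
    case (snoc d ds)
    let ?p = "p @ ds"
    have lab: "lab T1 (?p @ [d]) \<noteq> None" using snoc.prems by simp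
    have "lab T1 ?p \<noteq> None" by (rule is_tableau_prefix[OF L.is_tab lab]) simp
    then obtain ks where ks: "follows ?p (hs @ ks)" using snoc.IH by blast
    show ?case
    proof (cases "core_node T1 ?p")
      case False
      then have "follows (?p @ [d]) (hs @ ks)"
        using ks lab core_nodes_above_snoc[of T1 ?p d] unfolding follows_def by simp
      then show ?thesis by auto
    next
      case True
      have map: "map fst (hs @ ks) = core_nodes_above T1 ?p" and play: "play (hs @ ks)"
        using ks unfolding follows_def by auto
      have "\<exists>x. linked (hs @ ks) x \<and> fst x = ?p"
      proof (cases "hs @ ks = []")
        case empty: True
        then have "set (core_nodes_above T1 ?p) = {}" using map by simp
        then have "core_root T1 ?p"
          using True unfolding core_root_def set_core_nodes_above by blast
        from linked_root[OF this] show ?thesis unfolding empty .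
      next
        case False
        then have ne: "core_nodes_above T1 ?p \<noteq> []" using map by (metis map_is_Nil_conv)
        have "fst (last (hs @ ks)) = last (core_nodes_above T1 ?p)"
          using last_map[OF False, of fst] map by simp
        then have "core_succ T1 (fst (last (hs @ ks))) ?p"
          using core_nodes_above_last[OF ne] True unfolding core_succ_def by auto
        then show ?thesis using linked_succ[OF play False] by blast
      qed
      then obtain x where x: "linked (hs @ ks) x" "fst x = ?p" by blast
      have "follows (?p @ [d]) (hs @ ks @ [x])"
        using map play lab x play_snoc[of "hs @ ks" x] True core_nodes_above_snoc[of T1 ?p d]
        unfolding follows_def by simp
      then show ?thesis by auto
    qed
  qed
  moreover obtain ds where "q = p @ ds" using assms(2) by (rule prefixE)
  ultimately show ?thesis using assms(3) by blast
qed

lemma follows_modal_grows: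
  assumes "follows p hs" "follows q (hs @ ks)" "modal_between T1 p q"
  shows "ks \<noteq> []"
proof
  assume "ks = []"
  then have "core_nodes_above T1 p = core_nodes_above T1 q"
    using assms(1,2) unfolding follows_def by simp
  moreover obtain u where u: "prefix p u" "strict_prefix u q" "modal_node T1 u"
    using assms(3) unfolding modal_between_def by blast
  then have "u \<in> set (core_nodes_above T1 q)"
    unfolding set_core_nodes_above core_node_def by blast
  ultimately have "strict_prefix u p" unfolding set_core_nodes_above[symmetric]
    by (metis (mono_tags, lifting) mem_Collect_eq set_core_nodes_above)
  then show False using u(1) by (meson prefix_order.leD)
qed

text \<open>Before the first triple the default is the root \<open>[]\<close>. It has no strict
  prefix, so every regeneration above the first reply counts as new.\<close>

definition reply where
  "reply hs = (if hs = [] then [] else snd (snd (last hs)))"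

lemma reply_mono: "play (hs @ ks) \<Longrightarrow> prefix (reply hs) (reply (hs @ ks))"
proof (induction ks rule: rev_induct)
  case (snoc k ks)
  have "play (hs @ ks)" "linked (hs @ ks) k" using snoc.prems play_snoc[of "hs @ ks" k] by auto
  then have "prefix (reply (hs @ ks)) (reply (hs @ ks @ [k]))"
    unfolding reply_def linked_def core_succ_def strict_prefix_def by auto
  then show ?case using snoc.IH[OF \<open>play (hs @ ks)\<close>] by (meson prefix_order.trans)
qed simp

text \<open>The regeneration must lie on the segment that leads from the old reply, included, to the
  new one, excluded. Level 0 asks for nothing, as fits the base case of
  \<open>forced\<close>.\<close>

definition answers where
  "answers k hs hs' \<longleftrightarrow> k = 0 \<or>
     (\<exists>u Y. strict_prefix u (reply hs') \<and> \<not> strict_prefix u (reply hs) \<and>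
        active T2 u = Some (Var Y) \<and> k \<le> \<Omega> Y)"

lemma answers_mono:
  assumes "answers k (hs @ hs1) (hs @ hs1 @ hs2)" "play (hs @ hs1 @ hs2 @ hs3)"
  shows "answers k hs (hs @ hs1 @ hs2 @ hs3)"
proof (cases "k = 0")
  case False
  then obtain u Y where u: "strict_prefix u (reply (hs @ hs1 @ hs2))"
    "\<not> strict_prefix u (reply (hs @ hs1))" "active T2 u = Some (Var Y)" "k \<le> \<Omega> Y"
    using assms(1) unfolding answers_def by blast
  have "prefix (reply (hs @ hs1 @ hs2)) (reply (hs @ hs1 @ hs2 @ hs3))"
    using reply_mono[of "hs @ hs1 @ hs2" hs3] assms(2) by simp
  then have "strict_prefix u (reply (hs @ hs1 @ hs2 @ hs3))"
    using u(1) by (meson prefix_order.less_le_trans)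
  moreover have "prefix (reply hs) (reply (hs @ hs1))"
    using reply_mono[of hs hs1] play_prefix[of "hs @ hs1" "hs2 @ hs3"] assms(2) by simp
  then have "\<not> strict_prefix u (reply hs)" using u(2) by (meson prefix_order.less_le_trans)
  ultimately show ?thesis using u(3,4) unfolding answers_def by blast
qed (simp add: answers_def)

text \<open>On the left, \<open>X\<close> recurs and everything regenerated from \<open>P 0\<close>
  on is bound in \<open>\<beta>\<close>, so \<open>X\<close> decides the parity. On the right,
  priorities of at least \<open>k\<close> recur and none above \<open>k\<close> occurs from
  \<open>reply (H 0)\<close> on, so the greatest recurring priority is exactly \<open>k\<close>. The
  bisimulations equate the two parities.\<close>

lemma infinite_play_parity:
  assumes X: "binds \<phi>1 X \<beta> \<phi>"
    and follows: "\<And>i. follows (P i) (H i)"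
    and H: "\<And>i. strict_prefix (H i) (H (Suc i))"
    and within: "\<And>i. regenerates_within T1 (bound_vars \<beta>) (P 0) (P i)"
    and regen: "\<And>i. \<exists>u. prefix (P i) u \<and> strict_prefix u (P (Suc i)) \<and> active T1 u = Some (Var X)"
    and low: "\<And>i. answers k (H i) (H (Suc i))"
    and high: "\<And>i. \<not> answers (Suc k) (H 0) (H i)"
  shows "odd k = (X \<in> mu_bound \<phi>1)"
proof -
  have "strict_prefix (P i) (P (Suc i))" for i
    using regen[of i] by (meson prefix_order.le_less_trans)
  from list_limit[of P, OF this] obtain \<delta>1 where P: "P i = branch_node \<delta>1 (length (P i))" for i
    unfolding branch_node_def by blast
  from list_limit[of H, OF H] obtain h where h: "H i = map h [0..<length (H i)]" for i by blast
  have len_H: "i \<le> length (H i)" for i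
  proof (induction i)
    case (Suc i)
    then show ?case using prefix_length_less[OF H[of i]] by simp
  qed simp
  have len_P: "i \<le> length (P i)" for i
  proof (induction i)
    case (Suc i)
    then show ?case using prefix_length_less[OF \<open>\<And>i. strict_prefix (P i) (P (Suc i))\<close>[of i]] by simp
  qed simp
  have nth: "H (Suc i) ! i = h i" "take i (H (Suc i)) = map h [0..<i]" for i
    using len_H[of "Suc i"] by (subst h; simp add: take_map)+
  have linked: "linked (map h [0..<i]) (h i)" for i
    using follows[of "Suc i"] len_H[of "Suc i"] nth[of i] unfolding follows_def play_def
    by (metis Suc_le_lessD)
  have Z: "Z1 (fst (h i)) (fst (snd (h i)))" "Z2 (snd (snd (h i))) (fst (snd (h i)))" for i
    using linked[of i] unfolding linked_def by auto
  have paths: "core_path T1 (\<lambda>i. fst (h i))" "core_path T (\<lambda>i. fst (snd (h i)))"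
    "core_path T2 (\<lambda>i. snd (snd (h i)))"
    using linked[of 0] linked[of "Suc _"] unfolding core_path_def linked_def by auto
  have "odd_core_path T1 (\<lambda>i. fst (h i)) \<longleftrightarrow> odd_core_path T (\<lambda>i. fst (snd (h i)))"
    using Z1 paths(1,2) Z(1) unfolding core_bisimulation_def by blast
  also have "\<dots> \<longleftrightarrow> odd_core_path T2 (\<lambda>i. snd (snd (h i)))"
    using Z2 paths(2,3) Z(2) unfolding core_bisimulation_def by blast
  finally have equiv: "odd_core_path T1 (\<lambda>i. fst (h i)) \<longleftrightarrow> odd_core_path T2 (\<lambda>i. snd (snd (h i)))" .

  have branch1: "infinite_branch T1 \<delta>1"
    unfolding infinite_branch_def
  proof
    fix i
    have "prefix (branch_node \<delta>1 i) (P i)" using P[of i] len_P[of i] prefix_branch_node by metis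
    then show "lab T1 (branch_node \<delta>1 i) \<noteq> None"
      using is_tableau_prefix[OF L.is_tab] follows[of i] unfolding follows_def by blast
  qed
  have "fst (h i) \<in> range (branch_node \<delta>1)" for i
  proof -
    have "fst (h i) \<in> set (map fst (H (Suc i)))"
      using nth(1)[of i] len_H[of "Suc i"] by (metis Suc_le_lessD image_eqI list.set_map nth_mem)
    then have "strict_prefix (fst (h i)) (P (Suc i))"
      using follows[of "Suc i"] set_core_nodes_above[of T1 "P (Suc i)"] unfolding follows_def by auto
    then show ?thesis using P[of "Suc i"] strict_prefix_branch_node by (metis rangeI)
  qed
  then have odd1: "odd_core_path T1 (\<lambda>i. fst (h i)) \<longleftrightarrow> odd_branch T1 \<delta>1"
    using odd_core_path_iff[OF paths(1) branch1] by blast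
  obtain m1 where "disjunctive_branch T1 \<phi>1 \<delta>1 m1"
    using L.disjunctive_branch_exists[OF branch1] by blast
  then interpret B1: disjunctive_branch T1 \<phi>1 \<delta>1 m1 .
  have "\<exists>i \<ge> N. active T1 (branch_node \<delta>1 i) = Some (Var X)" for N
  proof -
    obtain u where u: "prefix (P N) u" "strict_prefix u (P (Suc N))" "active T1 u = Some (Var X)"
      using regen by blast
    obtain i where "u = branch_node \<delta>1 i" using u(2) P[of "Suc N"] strict_prefix_branch_node by metis
    moreover have "N \<le> length u" using len_P[of N] prefix_length_le[OF u(1)] by simp
    ultimately show ?thesis using u(3) by auto
  qed
  then have X_regen: "X \<in> regenerated_on T1 \<delta>1" unfolding regenerated_on_def INFM_nat_le by simp
  have outer1: "\<gamma> \<in> subfms \<beta>" if Y: "Y \<in> regenerated_on T1 \<delta>1" "binds \<phi>1 Y \<gamma> \<psi>" for Y \<gamma> \<psi>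
  proof -
    have "\<exists>i \<ge> length (P 0). active T1 (branch_node \<delta>1 i) = Some (Var Y)"
      using Y(1) unfolding regenerated_on_def INFM_nat_le by blast
    then obtain i where i: "i \<ge> length (P 0)" "active T1 (branch_node \<delta>1 i) = Some (Var Y)" by blast
    have "prefix (P 0) (branch_node \<delta>1 i)" using P[of 0] i(1) prefix_branch_node by metis
    moreover have "strict_prefix (branch_node \<delta>1 i) (P (Suc i))"
      using P[of "Suc i"] len_P[of "Suc i"] strict_prefix_branch_node by (metis Suc_le_lessD)
    ultimately have "Y \<in> bound_vars \<beta>"
      using within[of "Suc i"] i(2) unfolding regenerates_within_def by blast
    then obtain \<gamma>' \<psi>' where "binds \<beta> Y \<gamma>' \<psi>'" by (rule binds_obtain)
    then show ?thesis
      using binds_subfms[of \<beta> Y \<gamma>' \<psi>' \<phi>1] bindsD[OF X] bindsD[of \<beta> Y \<gamma>' \<psi>']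
        well_named_unique[OF L.named Y(2)] by blast
  qed
  have parity1: "odd_branch T1 \<delta>1 \<longleftrightarrow> X \<in> mu_bound \<phi>1"
    using B1.odd_branch_iff[OF X_regen X] outer1 by blast

  obtain \<delta>2 where branch2: "infinite_branch T2 \<delta>2"
    and C: "snd (snd (h i)) = branch_node \<delta>2 (length (snd (snd (h i))))" for i
    using core_path_branch[OF R.is_tab paths(3)] by metis
  have odd2: "odd_core_path T2 (\<lambda>i. snd (snd (h i))) \<longleftrightarrow> odd_branch T2 \<delta>2"
    by (rule odd_core_path_iff[OF paths(3) branch2]) (use C in blast)
  obtain m2 where "disjunctive_branch T2 \<phi>2 \<delta>2 m2"
    using R.disjunctive_branch_exists[OF branch2] by blast
  then interpret B2: disjunctive_branch T2 \<phi>2 \<delta>2 m2 .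
  have reply_h: "reply (H (Suc i)) = snd (snd (h (length (H (Suc i)) - 1)))" for i
    using len_H[of "Suc i"] unfolding reply_def by (subst (1 2 3) h) (auto simp: last_map)
  have reply_node: "reply (H i) = branch_node \<delta>2 (length (reply (H i)))" for i
  proof (cases "H i = []")
    case True
    then show ?thesis unfolding reply_def branch_node_def by simp
  next
    case False
    then have "reply (H i) = snd (snd (h (length (H i) - 1)))"
      unfolding reply_def by (subst (1 2) h) (auto simp: last_map)
    then show ?thesis using C by metis
  qed
  have reply_len: "i \<le> length (reply (H (Suc i)))" for i
    using core_path_length[OF paths(3), of "length (H (Suc i)) - 1"] len_H[of "Suc i"] reply_h[of i]
    by simp
  obtain X2 where X2: "X2 \<in> regenerated_on T2 \<delta>2"
    and max: "\<And>Y. Y \<in> regenerated_on T2 \<delta>2 \<Longrightarrow> \<Omega> Y \<le> \<Omega> X2"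
    and parity2: "odd_branch T2 \<delta>2 \<longleftrightarrow> odd (\<Omega> X2)"
    using B2.odd_branch_priority[OF \<Omega>] by blast
  have "k \<le> \<Omega> X2"
  proof (cases "k = 0")
    case False
    \<comment> \<open>The reply of \<open>H (Suc N)\<close> has length at least \<open>N\<close>, so
      a regeneration answered after it lies at depth at least \<open>N\<close>.\<close>
    have "\<exists>i \<ge> N. \<exists>Y. active T2 (branch_node \<delta>2 i) = Some (Var Y) \<and> k \<le> \<Omega> Y" for N
    proof -
      obtain u Y where u: "strict_prefix u (reply (H (Suc (Suc N))))"
        "\<not> strict_prefix u (reply (H (Suc N)))" "active T2 u = Some (Var Y)" "k \<le> \<Omega> Y"
        using low[of "Suc N"] False unfolding answers_def by blast
      obtain i where i: "u = branch_node \<delta>2 i"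
        using u(1) reply_node strict_prefix_branch_node by metis
      have "\<not> i < length (reply (H (Suc N)))"
        using u(2) i reply_node strict_prefix_branch_node by metis
      then have "N \<le> i" using reply_len[of N] by simp
      then show ?thesis using u(3,4) i by blast
    qed
    then obtain Y where "Y \<in> regenerated_on T2 \<delta>2" "k \<le> \<Omega> Y"
      using B2.frequently_regenerated[of "\<lambda>Y. k \<le> \<Omega> Y"] unfolding INFM_nat_le by blast
    then show ?thesis using max by (meson le_trans)
  qed simp
  moreover have "\<not> Suc k \<le> \<Omega> X2"
  proof
    assume "Suc k \<le> \<Omega> X2"
    have "\<exists>i \<ge> length (reply (H 0)). active T2 (branch_node \<delta>2 i) = Some (Var X2)"
      using X2 unfolding regenerated_on_def INFM_nat_le by blast
    then obtain i where i: "i \<ge> length (reply (H 0))" "active T2 (branch_node \<delta>2 i) = Some (Var X2)"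
      by blast
    have "strict_prefix (branch_node \<delta>2 i) (reply (H (Suc (Suc i))))"
      using reply_node[of "Suc (Suc i)"] reply_len[of "Suc i"] strict_prefix_branch_node
      by (metis Suc_le_lessD)
    moreover have "\<not> strict_prefix (branch_node \<delta>2 i) (reply (H 0))"
      using i(1) prefix_length_less by fastforce
    ultimately show False
      using high[of "Suc (Suc i)"] i(2) \<open>Suc k \<le> \<Omega> X2\<close> unfolding answers_def by blast
  qed
  ultimately have "\<Omega> X2 = k" by simp
  then show ?thesis using equiv odd1 odd2 parity1 parity2 by simp
qed

lemma forced_answers:
  assumes "forced \<phi>1 k X" "binds \<phi>1 X \<beta> \<phi>" "follows p hs" "lab T1 p = Some {\<phi>}"
  shows "\<exists>q ks. follows q (hs @ ks) \<and> lab T1 q = Some {\<phi>} \<and>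
    regenerates_within T1 (bound_vars \<beta>) p q \<and> answers k hs (hs @ ks)"
  using assms
proof (induction arbitrary: \<beta> \<phi> p hs rule: forced.induct)
  case (zero X)
  then show ?case by (intro exI[of _ p] exI[of _ "[]"]) (simp add: answers_def)
next
  case (depends k Z X)
  have Zbound: "Z \<in> bound_vars \<phi>1" using forced_bound_vars[OF depends.hyps(1)] .
  then obtain \<gamma> \<psi> where \<gamma>: "binds \<phi>1 Z \<gamma> \<psi>" by (rule binds_obtain)
  note nested = depends_nested[OF L.named depends.hyps(2) \<gamma> depends.prems(1)]
  have \<phi>: "\<phi> \<in> subfms \<phi>1" "\<phi> \<in> subfms \<beta>" "disjunctive \<phi>" "disjunctive \<psi>" "\<psi> \<in> subfms \<phi>1"
    using bindsD[OF depends.prems(1)] binds_disjunctive[OF L.disj depends.prems(1)]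
      binds_disjunctive[OF L.disj \<gamma>] bindsD[OF \<gamma>] by auto
  have \<gamma>\<phi>: "binds \<phi> Z \<gamma> \<psi>" using nested(1) \<gamma> unfolding binds_def by blast
  have sub: "bound_vars \<gamma> \<subseteq> bound_vars \<beta>"
    using bound_vars_mono[OF nested(1)] bound_vars_mono[OF \<phi>(2)] by blast
  have X_in: "X \<in> bound_vars \<beta>" "X \<in> free_vars \<psi>"
    using depends.prems(1) nested(2) \<gamma> unfolding binds_def by auto
  \<comment> \<open>The binder of \<open>Z\<close> lies inside \<open>\<phi>\<close> and
    \<open>X\<close> is free in its body \<open>\<psi>\<close>. The branch descends to
    \<open>\<psi>\<close>, lets the hypothesis for \<open>Z\<close> answer \<open>k\<close>, and
    returns to \<open>\<phi>\<close> by regenerating \<open>X\<close>.\<close>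
  from L.reach_binder_body[OF depends.prems(3) \<phi>(1,3) \<gamma>\<phi>] obtain q1 where
    q1: "lab T1 q1 = Some {\<psi>}" "regenerates_within T1 {} p q1" by blast
  from follows_extend[OF depends.prems(2) regenerates_within_prefix[OF q1(2)]] q1(1)
  obtain ks1 where ks1: "follows q1 (hs @ ks1)" by auto
  from depends.IH[OF \<gamma> ks1 q1(1)] obtain q2 ks2 where
    q2: "follows q2 ((hs @ ks1) @ ks2)" "lab T1 q2 = Some {\<psi>}"
      "regenerates_within T1 (bound_vars \<gamma>) q1 q2" "answers k (hs @ ks1) ((hs @ ks1) @ ks2)" by blast
  from L.reach_regeneration[OF q2(2) \<phi>(5,4) X_in(2) depends.prems(1)] obtain q3 where
    q3: "lab T1 q3 = Some {\<phi>}" "regenerates_within T1 {X} q2 q3" by blast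
  from follows_extend[OF q2(1) regenerates_within_prefix[OF q3(2)]] q3(1)
  obtain ks3 where ks3: "follows q3 (hs @ ks1 @ ks2 @ ks3)" by auto
  have "regenerates_within T1 (bound_vars \<beta>) p q3"
    using regenerates_within_trans regenerates_within_mono[OF q1(2)]
      regenerates_within_mono[OF q2(3) sub] regenerates_within_mono[OF q3(2)] X_in(1)
    by (metis empty_subsetI insert_subset)
  moreover have "answers k hs (hs @ ks1 @ ks2 @ ks3)"
    using answers_mono[of k hs ks1 ks2 ks3] q2(4) ks3 unfolding follows_def by simp
  ultimately show ?case using ks3 q3(1) by blast
next
  case (parity k X)
  show ?case
    \<comment> \<open>Otherwise the loops for \<open>k\<close>, each followed by a regeneration of \<open>X\<close>, could be repeated forever:
      the right branch would then have the parity of \<open>k\<close>, the left one that of \<open>X\<close>.\<close>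
  proof (rule ccontr)
    assume none: "\<not> ?case"
    \<comment> \<open>A state is a node with its play. \<open>P\<close> says that it would witness
      the goal except for answering \<open>Suc k\<close>, so \<open>none\<close> denies that answer
      at every state; \<open>Q\<close> collects what one round has to achieve.\<close>
    define P where "P s \<longleftrightarrow> follows (fst s) (snd s) \<and> prefix hs (snd s) \<and>
      lab T1 (fst s) = Some {\<phi>} \<and> regenerates_within T1 (bound_vars \<beta>) p (fst s)" for s
    define Q where "Q s s' \<longleftrightarrow> strict_prefix (snd s) (snd s') \<and> answers k (snd s) (snd s') \<and>
      (\<exists>u. prefix (fst s) u \<and> strict_prefix u (fst s') \<and> active T1 u = Some (Var X))"
      for s s' :: "('p, 'v) node \<times> ('p, 'v) node_triple list"
    have X_in: "X \<in> bound_vars \<beta>" using parity.prems(1) unfolding binds_def by auto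
    have "\<exists>s'. P s' \<and> Q s s'" if s: "P s" for s
    proof -
      obtain p' hs' where s_eq: "s = (p', hs')" by (cases s)
      have s': "follows p' hs'" "prefix hs hs'" "lab T1 p' = Some {\<phi>}"
        "regenerates_within T1 (bound_vars \<beta>) p p'"
        using s unfolding P_def s_eq by auto
      from parity.IH[OF parity.prems(1) s'(1,3)] obtain q1 ks1 where
        q1: "follows q1 (hs' @ ks1)" "lab T1 q1 = Some {\<phi>}"
          "regenerates_within T1 (bound_vars \<beta>) p' q1" "answers k hs' (hs' @ ks1)" by blast
      from L.body_loop[OF q1(2) parity.prems(1)] obtain q2 u where
        q2: "lab T1 q2 = Some {\<phi>}" "regenerates_within T1 {X} q1 q2" "modal_between T1 q1 q2"
        and u: "prefix q1 u" "strict_prefix u q2" "active T1 u = Some (Var X)" by blast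
      from follows_extend[OF q1(1) regenerates_within_prefix[OF q2(2)]] q2(1)
      obtain ks2 where ks2: "follows q2 ((hs' @ ks1) @ ks2)" by auto
      \<comment> \<open>The loop answering \<open>k\<close> may be empty, for instance when
        \<open>k = 0\<close>; it is the modal node on the loop through \<open>X\<close> that makes
        the play grow.\<close>
      have "ks2 \<noteq> []" using follows_modal_grows[OF q1(1) ks2 q2(3)] .
      then have "strict_prefix hs' (hs' @ ks1 @ ks2)" by (simp add: strict_prefix_def)
      moreover have "answers k hs' (hs' @ ks1 @ ks2)"
        using answers_mono[of k hs' "[]" ks1 ks2] q1(4) ks2 unfolding follows_def by simp
      moreover have "prefix p' u"
        using regenerates_within_prefix[OF q1(3)] u(1) by (meson prefix_order.trans)
      moreover have "regenerates_within T1 (bound_vars \<beta>) p q2"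
        using regenerates_within_trans s'(4) q1(3) regenerates_within_mono[OF q2(2)] X_in
        by (metis empty_subsetI insert_subset)
      ultimately show ?thesis
        using s' q2(1) ks2 u(2,3) unfolding P_def Q_def s_eq
        by (intro exI[of _ "(q2, hs' @ ks1 @ ks2)"]) auto
    qed
    moreover have "P (p, hs)" using parity.prems(2,3) unfolding P_def by simp
    ultimately have "\<exists>f. \<forall>i. (P (f i) \<and> (i = 0 \<longrightarrow> f i = (p, hs))) \<and> Q (f i) (f (Suc i))"
      by (intro dependent_nat_choice) auto
    then obtain f where f: "\<And>i. P (f i)" "f 0 = (p, hs)" "\<And>i. Q (f i) (f (Suc i))" by blast
    have "odd k = (X \<in> mu_bound \<phi>1)"
    proof (rule infinite_play_parity[OF parity.prems(1), of "\<lambda>i. fst (f i)" "\<lambda>i. snd (f i)"])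
      fix i
      show "\<not> answers (Suc k) (snd (f 0)) (snd (f i))"
        using none f(1)[of i] f(2) unfolding P_def by (auto elim!: prefixE)
    qed (use f in \<open>auto simp: P_def Q_def\<close>)
    then show False using parity.hyps(2) by simp
  qed
qed

text \<open>A single answer suffices: it exhibits a bound variable of \<open>\<phi>2\<close> with
  priority at least \<open>k\<close>, and priorities do not exceed \<open>n\<close>.\<close>

lemma forced_le_priority:
  assumes "forced \<phi>1 k X"
  shows "k \<le> n"
proof -
  from forced_bound_vars[OF assms] obtain \<beta> \<phi> where \<beta>: "binds \<phi>1 X \<beta> \<phi>" by (rule binds_obtain)
  have root: "lab T1 [] = Some {\<phi>1}" using L.is_tab unfolding is_tableau_def by simp
  from L.reach_binder_body[OF root subfms_refl L.disj \<beta>] obtain p where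
    p: "lab T1 p = Some {\<phi>}" by blast
  obtain hs where hs: "follows p hs" using follows_extend[OF follows_Nil, of p] p by auto
  from forced_answers[OF assms \<beta> hs p] obtain q ks where
    q: "follows q (hs @ ks)" "answers k hs (hs @ ks)" by blast
  show ?thesis
  proof (cases "k = 0")
    case False
    then obtain u Y where u: "strict_prefix u (reply (hs @ ks))" "active T2 u = Some (Var Y)" "k \<le> \<Omega> Y"
      using q(2) unfolding answers_def by blast
    have ne: "hs @ ks \<noteq> []" using u(1) unfolding reply_def by (auto split: if_splits)
    then have "play (butlast (hs @ ks) @ [last (hs @ ks)])" using q(1) unfolding follows_def by simp
    then have "Z2 (reply (hs @ ks)) (fst (snd (last (hs @ ks))))"
      unfolding play_snoc linked_def reply_def if_not_P[OF ne] by blast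
    then have "core_node T2 (reply (hs @ ks))" using Z2 unfolding core_bisimulation_def by blast
    then have "lab T2 u \<noteq> None"
      using is_tableau_prefix[OF R.is_tab core_node_lab] u(1) unfolding strict_prefix_def by blast
    then have "Y \<in> bound_vars \<phi>2" using R.active_bound_var u(2) by blast
    then have "\<Omega> Y \<le> n" using \<Omega> unfolding priority_assignment_def by auto
    then show ?thesis using u(3) by simp
  qed simp
qed

end

theorem theorem3:
  fixes T T1 T2 :: "('p, 'v) tableau" and \<Psi> \<phi>1 \<phi>2 :: "('p, 'v) fm"
  assumes "well_formed \<Psi>" and "tableau_of T \<Psi>"
    and "well_formed \<phi>1" and "disjunctive \<phi>1" and "no_dead_fixpoints \<phi>1"
    and "well_formed \<phi>2" and "disjunctive \<phi>2" and "no_dead_fixpoints \<phi>2"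
    and "tableau_of T1 \<phi>1" and "tableau_equiv T1 T"
    and "tableau_of T2 \<phi>2" and "tableau_equiv T2 T"
  shows "alternation_depth \<phi>1 = alternation_depth \<phi>2"
proof -
  obtain Z1 Z2 where Z: "core_bisimulation T1 T Z1" "core_bisimulation T2 T Z2"
    using assms(10,12) unfolding tableau_equiv_def by blast
  have T: "is_tableau T" using assms(2) unfolding tableau_of_def by simp
  have named: "well_named \<phi>1" "well_named \<phi>2"
    using assms(3,6) unfolding well_formed_def by auto
  have "k \<le> n" if "forced \<phi>1 k X" "priority_assignment \<phi>2 n \<Omega>" for k X n \<Omega>
  proof -
    interpret linked_tableaus T1 T2 \<phi>1 \<phi>2 T Z1 Z2 n \<Omega>
      by unfold_locales (use assms T Z that in auto)
    show ?thesis using forced_le_priority[OF that(1)] .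
  qed
  \<comment> \<open>The same argument with the sides exchanged; both bisimulations lead into
    \<open>T\<close>, so none has to be inverted.\<close>
  moreover have "k \<le> n" if "forced \<phi>2 k X" "priority_assignment \<phi>1 n \<Omega>" for k X n \<Omega>
  proof -
    interpret linked_tableaus T2 T1 \<phi>2 \<phi>1 T Z2 Z1 n \<Omega>
      by unfold_locales (use assms T Z that in auto)
    show ?thesis using forced_le_priority[OF that(1)] .
  qed
  ultimately show ?thesis
    unfolding alternation_depth_def
    using alternation_depth_le[OF named] alternation_depth_le[OF named(2,1)] by (metis le_antisym)
qed

end
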